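(* Let $e\ge0$, $r\ge1$, $n\ge0$ be integers, and let $\chi(r)=1$ if $r=1$ and $\chi(r)=0$ if $r\ge2$. Then, as power series in $x$, $$\sigma_{P_n(e,r)}(x)=\sigma_{K_{\mu(\emptyset)}}(x)+\sum_{j=1}^n\sigma_{K_{\mu(\{j\})}}(x)+\chi(r)\sum_{j_1=1}^{n}\ \sum_{j_2=j_1+2}^{n}\sigma_{K_{\mu(\{j_1,j_2\})}}(x)+O\!\left(x^{(e+1)(r+1)^n}\right),$$ and this enumerates the minimal $(e,r)$-partitions: for every integer $m$ with $(e+1)\frac{(r+1)^n-1}{r}+1\le m\le (e+1)\frac{(r+1)^{n+1}-1}{r}$, the number of minimal $(e,r)$-partitions of $m$ equals the coefficient of $x^{\frac{e+1}{r}((r+1)^{n+1}-1)-m}$ in $\sigma_{P_n(e,r)}(x)$.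
   Context: Partitions. A partition $m=\lambda_0+\cdots+\lambda_k$ with positive integer parts in (weakly) increasing order is an $(e,r)$-partition if no $e+1$ consecutive integers between $0$ and $rm$ are all absent from $\{\sum_{i=0}^k\alpha_i\lambda_i:\alpha_i\in\{0,1,\ldots,r\}\}$. It is minimal if its number of parts is the smallest possible among all $(e,r)$-partitions of $m$. Polyhedron. For $\mu=(\mu_0,\ldots,\mu_n)\in\mathbb R^{n+1}$ write $|\mu|:=\mu_0+\cdots+\mu_n$ (the signed coordinate sum). $P_n(e,r)\subset\mathbb R^{n+1}$ is the set of $\mu$ satisfying $0\le\mu_0\le e$ and, for $i=1,\ldots,n$, $r\sum_{j=0}^{i-1}\mu_j\le\mu_i\le (e+1)r(r+1)^{i-1}+\mu_{i-1}$. For $S\subseteq\{0,1,\ldots,n\}$, $\mu(S)$ is the unique point such that: for $i\ge1$, $\mu_i=(e+1)r(r+1)^{i-1}+\mu_{i-1}$ if $i\in S$ and $\mu_i=r\sum_{j=0}^{i-1}\mu_j$ if $i\notin S$; and $\mu_0=e$ if $0\in S$, $\mu_0=0$ if $0\notin S$. The points $\mu(S)$ are the vertices of $P_n(e,r)$. Set $\sigma_{P_n(e,r)}(x):=\sum_{\mu\in P_n(e,r)\cap\mathbb Z^{n+1}}x^{|\mu|}$. Vertex cones. For distinct integer vectors $u,u'$ let $p_u(u')$ be $u'-u$ divided by the greatest common divisor of its entries. For a vertex $v$ of $P_n(e,r)$ let $N(v)$ be the set of vertices of $P_n(e,r)$ joined to $v$ by an edge, let $K_v=v+\mathbb R_{\ge0}\{p_v(v'):v'\in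 N(v)\}$ be the vertex cone at $v$, and put $$\sigma_{K_v}(x):=x^{|v|}\prod_{v'\in N(v)}\frac{1}{1-x^{|p_v(v')|}},$$ a rational function which is expanded as a power series in $x$ about $0$ (so a factor with $|p_v(v')|<0$ is rewritten as $-x^{|p_{v'}(v)|}/(1-x^{|p_{v'}(v)|})$). (When $e=0$ the polyhedron lies in the hyperplane $\mu_0=0$ and has dimension $n$ instead of $n+1$; the same definitions are used, with edges and vertices taken in $P_n(0,r)$.) The notation $O(x^N)$ stands for a power series all of whose terms have degree at least $N$. *)

theory Defs
  imports
    "HOL-Complex_Analysis.Complex_Analysis"
    "HOL-Library.Function_Algebras"
begin

text \<open>
  Points of \<open>\<real>\<^bsup>n+1\<^esup>\<close>, with \<open>n\<close> a natural number that occurs in the formulas, are functions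
  \<^typ>\<open>nat \<Rightarrow> real\<close> that vanish at every index \<open>> n\<close>. With the pointwise real vector space structure
  on functions, the library notions \<^const>\<open>extreme_point_of\<close>, \<^const>\<open>closed_segment\<close> and
  \<^const>\<open>face_of\<close> apply to them.
\<close>

instantiation "fun" :: (type, real_vector) real_vector
begin

definition scaleR_fun_def: "c *\<^sub>R f = (\<lambda>x. c *\<^sub>R f x)"

instance
  by standard (auto simp: scaleR_fun_def scaleR_add_right scaleR_add_left)

end

subsection \<open>Partitions\<close>

definition is_partition :: "nat \<Rightarrow> nat list \<Rightarrow> bool" where
  "is_partition m l \<longleftrightarrow> l \<noteq> [] \<and> sorted l \<and> (\<forall>a\<in>set l. 0 < a) \<and> sum_list l = m"

definition represented :: "nat \<Rightarrow> nat list \<Rightarrow> nat set" where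
  "represented r l = {\<Sum>i<length l. \<alpha> i * l ! i | \<alpha>. \<forall>i<length l. \<alpha> i \<in> {0..r}}"

definition er_partition :: "nat \<Rightarrow> nat \<Rightarrow> nat \<Rightarrow> nat list \<Rightarrow> bool" where
  "er_partition e r m l \<longleftrightarrow> is_partition m l \<and>
     \<not> (\<exists>a. a + e \<le> r * m \<and> (\<forall>t\<in>{a..a + e}. t \<notin> represented r l))"

definition minimal_er_partition :: "nat \<Rightarrow> nat \<Rightarrow> nat \<Rightarrow> nat list \<Rightarrow> bool" where
  "minimal_er_partition e r m l \<longleftrightarrow>
     er_partition e r m l \<and> (\<forall>l'. er_partition e r m l' \<longrightarrow> length l \<le> length l')"

subsection \<open>The polyhedron\<close>

definition polyP :: "nat \<Rightarrow> nat \<Rightarrow> nat \<Rightarrow> (nat \<Rightarrow> real) set" where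
  "polyP n e r = {\<mu>. 0 \<le> \<mu> 0 \<and> \<mu> 0 \<le> real e \<and>
     (\<forall>i\<in>{1..n}. real r * (\<Sum>j<i. \<mu> j) \<le> \<mu> i \<and>
        \<mu> i \<le> (real e + 1) * real r * (real r + 1) ^ (i - 1) + \<mu> (i - 1)) \<and>
     (\<forall>i>n. \<mu> i = 0)}"

text \<open>\<open>vertex_seq e r S\<close> is the infinite sequence of which \<open>\<mu>(S)\<close> is the initial segment.\<close>

function vertex_seq :: "nat \<Rightarrow> nat \<Rightarrow> nat set \<Rightarrow> nat \<Rightarrow> int" where
  "vertex_seq e r S i =
     (if i = 0 then (if 0 \<in> S then int e else 0)
      else if i \<in> S then (int e + 1) * int r * (int r + 1) ^ (i - 1) + vertex_seq e r S (i - 1)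
      else int r * (\<Sum>j<i. vertex_seq e r S j))"
  by auto
termination by (relation "Wellfounded.measure (\<lambda>(e, r, S, i). i)") auto

declare vertex_seq.simps [simp del]

definition vertex :: "nat \<Rightarrow> nat \<Rightarrow> nat \<Rightarrow> nat set \<Rightarrow> nat \<Rightarrow> int" where
  "vertex n e r S = (\<lambda>i. if i \<le> n then vertex_seq e r S i else 0)"

definition coord_sum :: "nat \<Rightarrow> (nat \<Rightarrow> int) \<Rightarrow> int" where
  "coord_sum n \<mu> = (\<Sum>i\<le>n. \<mu> i)"

definition real_vec :: "(nat \<Rightarrow> int) \<Rightarrow> nat \<Rightarrow> real" where
  "real_vec \<mu> = (\<lambda>i. real_of_int (\<mu> i))"

definition lattice_points :: "(nat \<Rightarrow> real) set \<Rightarrow> (nat \<Rightarrow> int) set" where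
  "lattice_points Q = {\<mu>. real_vec \<mu> \<in> Q}"

definition primitive_dir :: "(nat \<Rightarrow> int) \<Rightarrow> (nat \<Rightarrow> int) \<Rightarrow> nat \<Rightarrow> int" where
  "primitive_dir u u' = (\<lambda>i. (u' i - u i) div Gcd (range (\<lambda>k. u' k - u k)))"

text \<open>
  The edge joining two distinct vertices is the segment between them, provided it is a face;
  \<^const>\<open>edge_of\<close> itself is only available on Euclidean space types. All vertices of \<^term>\<open>polyP n e r\<close>
  are of the form \<^term>\<open>real_vec (vertex n e r S)\<close>, so restricting to integer vectors loses none.
\<close>

definition neighbours :: "(nat \<Rightarrow> real) set \<Rightarrow> (nat \<Rightarrow> int) \<Rightarrow> (nat \<Rightarrow> int) set" where
  "neighbours Q v = {v'. v' \<noteq> v \<and>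
     real_vec v extreme_point_of Q \<and> real_vec v' extreme_point_of Q \<and>
     closed_segment (real_vec v) (real_vec v') face_of Q}"

subsection \<open>Generating functions\<close>

text \<open>
  Formal Laurent series over a field form a field, in which the inverse of \<open>1 - x\<^sup>d\<close> is, for every
  integer \<open>d \<noteq> 0\<close>, the expansion about 0 of that rational function; for \<open>d < 0\<close> it is
  \<open>- x\<^bsup>-d\<^esup> / (1 - x\<^bsup>-d\<^esup>)\<close>.
\<close>

definition sigma_P :: "nat \<Rightarrow> nat \<Rightarrow> nat \<Rightarrow> rat fls" where
  "sigma_P n e r = (\<Sum>\<mu>\<in>lattice_points (polyP n e r). fls_X_intpow (coord_sum n \<mu>))"

definition sigma_K :: "nat \<Rightarrow> nat \<Rightarrow> nat \<Rightarrow> (nat \<Rightarrow> int) \<Rightarrow> rat fls" where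
  "sigma_K n e r v = fls_X_intpow (coord_sum n v) *
     (\<Prod>v'\<in>neighbours (polyP n e r) v. 1 / (1 - fls_X_intpow (coord_sum n (primitive_dir v v'))))"

definition chi :: "nat \<Rightarrow> rat fls" where
  "chi r = (if r = 1 then 1 else 0)"

subsection \<open>The sums and products above range over finite sets\<close>

lemma polyP_coord_bounds:
  assumes "\<mu> \<in> polyP n e r" "i \<le> n"
  shows "0 \<le> \<mu> i \<and> \<mu> i \<le> real e + real i * ((real e + 1) * real r * (real r + 1) ^ n)"
  using assms(2)
proof (induction i rule: less_induct)
  case (less i)
  define C where "C = (real e + 1) * real r * (real r + 1) ^ n"
  show ?case
  proof (cases i)
    case 0
    then show ?thesis using assms(1) by (simp add: polyP_def)
  next
    case (Suc k)
    have i: "i \<in> {1..n}" using less.prems Suc by auto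
    have "0 \<le> (\<Sum>j<i. \<mu> j)" by (rule sum_nonneg) (use less in auto)
    then have "0 \<le> real r * (\<Sum>j<i. \<mu> j)" by simp
    also have "\<dots> \<le> \<mu> i" using assms(1) i unfolding polyP_def by blast
    finally have lo: "0 \<le> \<mu> i" .
    have "\<mu> i \<le> (real e + 1) * real r * (real r + 1) ^ (i - 1) + \<mu> (i - 1)"
      using assms(1) i unfolding polyP_def by blast
    also have "(real e + 1) * real r * (real r + 1) ^ (i - 1) \<le> C"
      unfolding C_def using less.prems by (intro mult_left_mono power_increasing) auto
    also have "\<mu> (i - 1) \<le> real e + real k * C"
      using less.IH[of k] less.prems Suc by (simp add: C_def)
    finally have "\<mu> i \<le> C + (real e + real k * C)" by simp
    also have "\<dots> = real e + real i * C" using Suc by (simp add: algebra_simps)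
    finally show ?thesis using lo unfolding C_def by blast
  qed
qed

lemma finite_lattice_points: "finite (lattice_points (polyP n e r))"
proof -
  define B where "B = real e + real n * ((real e + 1) * real r * (real r + 1) ^ n)"
  have bnd: "\<mu> i \<in> {0..\<lfloor>B\<rfloor>}" if "\<mu> \<in> lattice_points (polyP n e r)" "i \<le> n" for \<mu> i
  proof -
    define C where "C = (real e + 1) * real r * (real r + 1) ^ n"
    have "0 \<le> C" by (simp add: C_def)
    then have "real e + real i * C \<le> B"
      unfolding B_def C_def[symmetric] using that(2) by (intro add_left_mono mult_right_mono) auto
    then show ?thesis
      using polyP_coord_bounds[of "real_vec \<mu>" n e r i] that
      unfolding C_def[symmetric] by (auto simp: lattice_points_def real_vec_def le_floor_iff)
  qed
  have zero: "\<mu> i = 0" if "\<mu> \<in> lattice_points (polyP n e r)" "i > n" for \<mu> i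
    using that by (auto simp: lattice_points_def polyP_def real_vec_def)
  have "lattice_points (polyP n e r) \<subseteq>
      {f. \<forall>i. (i \<in> {..n} \<longrightarrow> f i \<in> {0..\<lfloor>B\<rfloor>}) \<and> (i \<notin> {..n} \<longrightarrow> f i = 0)}"
  proof (intro subsetI CollectI allI conjI impI)
    fix \<mu> i assume "\<mu> \<in> lattice_points (polyP n e r)" "i \<in> {..n}"
    then show "\<mu> i \<in> {0..\<lfloor>B\<rfloor>}" using bnd by simp
  next
    fix \<mu> i assume "\<mu> \<in> lattice_points (polyP n e r)" "i \<notin> {..n}"
    then show "\<mu> i = 0" by (intro zero) simp_all
  qed
  then show ?thesis
    by (rule finite_subset) (intro finite_set_of_finite_funs finite_atMost finite_atLeastAtMost_int)
qed

lemma finite_neighbours: "finite (neighbours (polyP n e r) v)"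
proof (rule finite_subset[OF _ finite_lattice_points[of n e r]])
  show "neighbours (polyP n e r) v \<subseteq> lattice_points (polyP n e r)"
    unfolding neighbours_def lattice_points_def extreme_point_of_def by blast
qed

end

theory Submission
  imports Defs
begin

text \<open>
  Given \<open>\<mu>\<^sub>0, \<dots>, \<mu>\<^bsub>i-1\<^esub>\<close>, the coordinate \<open>\<mu>\<^sub>i\<close> of a point of \<open>P\<close> runs over an interval of positive
  length (a point if \<open>i = e = 0\<close>) whose ends are affine in the earlier coordinates. So \<open>P\<close> is
  combinatorially a cube: the edges at \<open>\<mu>(S)\<close> end at the \<open>\<mu>(S')\<close> where \<open>S'\<close> differs from \<open>S\<close> in
  one element \<open>i\<close>, and the edge direction is primitive because its first nonzero entry is \<open>\<plusminus>1\<close>, at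
  position \<open>i\<close>. Summing \<open>x\<^bsup>w\<cdot>\<mu>\<^esup>\<close> over the last coordinate is a geometric sum with one contribution
  per end of the interval, and each contribution is a weighted sum over \<open>P\<^bsub>n-1\<^esub>\<close> with changed positive
  weights; iterating, \<open>\<sigma>\<^sub>P\<close> is the sum of all \<open>\<sigma>\<^sub>K\<close> over the vertices. The same recursion on weights
  yields the order in \<open>x\<close> of the contribution of \<open>\<mu>(S)\<close>, which is at least \<open>(e+1)(r+1)\<^sup>n\<close> except for
  the sets \<open>S\<close> listed in the theorem.

  A partition is an \<open>(e,r)\<close>-partition iff \<open>\<lambda>\<^sub>i \<le> e + 1 + r(\<lambda>\<^sub>0 + \<cdots> + \<lambda>\<^bsub>i-1\<^esub>)\<close> for all \<open>i\<close>. This bounds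
  the sum of \<open>k\<close> parts, so the minimal ones in the given range have \<open>n+1\<close> parts, and
  \<open>\<mu>\<^sub>i = (e+1)(r+1)\<^sup>i - \<lambda>\<^sub>i\<close> turns these conditions, \<open>\<lambda>\<^bsub>i-1\<^esub> \<le> \<lambda>\<^sub>i\<close> and \<open>\<lambda>\<^sub>0 \<ge> 1\<close> into the
  inequalities of \<open>P\<close>.
\<close>

subsection \<open>The facet inequalities\<close>

text \<open>Indexing the two inequalities of a coordinate by a Boolean treats both ends alike:
  \<mu>(S) is the point of R^(n+1) with \<open>slack e r j (j \<in> S) x = 0\<close> for all j \<le>
  n, and the opposite facet is reached by negating \<open>b\<close>.\<close>

definition slack :: "nat \<Rightarrow> nat \<Rightarrow> nat \<Rightarrow> bool \<Rightarrow> (nat \<Rightarrow> real) \<Rightarrow> real" where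
  "slack e r j b x =
     (if j = 0 then (if b then real e - x 0 else x 0)
      else if b then (real e + 1) * real r * (real r + 1) ^ (j - 1) + x (j - 1) - x j
      else x j - real r * (\<Sum>k<j. x k))"

lemma polyP_iff_slack:
  "x \<in> polyP n e r \<longleftrightarrow> (\<forall>j\<le>n. \<forall>b. 0 \<le> slack e r j b x) \<and> (\<forall>j>n. x j = 0)"
proof -
  have "(\<forall>j\<le>n. \<forall>b. 0 \<le> slack e r j b x) \<longleftrightarrow>
      (\<forall>b. 0 \<le> slack e r 0 b x) \<and> (\<forall>j\<in>{1..n}. \<forall>b. 0 \<le> slack e r j b x)"
    by (metis One_nat_def Suc_leI atLeastAtMost_iff le0 neq0_conv)
  then show ?thesis
    unfolding polyP_def by (auto simp: slack_def all_bool_eq)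
qed

lemma slack_convex:
  "slack e r j b ((1 - u) *\<^sub>R x + u *\<^sub>R y) = (1 - u) * slack e r j b x + u * slack e r j b y"
proof -
  have "(\<Sum>k<j. ((1 - u) *\<^sub>R x + u *\<^sub>R y) k) = (1 - u) * (\<Sum>k<j. x k) + u * (\<Sum>k<j. y k)"
    by (simp add: scaleR_fun_def sum.distrib sum_distrib_left)
  then show ?thesis by (simp add: slack_def scaleR_fun_def) (simp add: algebra_simps)
qed

lemma geometric_sum_eq:
  "real r * (\<Sum>k<p. (real e + 1) * (real r + 1) ^ k) = (real e + 1) * ((real r + 1) ^ p - 1)"
  by (induction p) (auto simp: algebra_simps)

text \<open>After \<open>x (j - 1)\<close> is subtracted it keeps the coefficient r - 1 \<ge> 0, so
  the upper bounds may be inserted for all coordinates; the two sides then differ by at least e +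
  r.\<close>

lemma lower_plus_1_le_upper:
  fixes x :: "nat \<Rightarrow> real"
  assumes "r \<ge> 1" "j \<ge> 1" and ub: "\<And>k. k < j \<Longrightarrow> x k \<le> (real e + 1) * (real r + 1) ^ k - 1"
  shows "real r * (\<Sum>k<j. x k) + 1 \<le> (real e + 1) * real r * (real r + 1) ^ (j - 1) + x (j - 1)"
proof -
  obtain p where p: "j = Suc p" using assms(2) by (cases j) auto
  have "(\<Sum>k<p. x k) \<le> (\<Sum>k<p. (real e + 1) * (real r + 1) ^ k)"
    by (rule sum_mono) (use ub p in \<open>force dest: less_SucI\<close>)
  then have "real r * (\<Sum>k<p. x k) \<le> (real e + 1) * ((real r + 1) ^ p - 1)"
    unfolding geometric_sum_eq[symmetric] by (intro mult_left_mono) auto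
  moreover have "(real r - 1) * x p \<le> (real r - 1) * ((real e + 1) * (real r + 1) ^ p - 1)"
    using ub[of p] p assms(1) by (intro mult_left_mono) auto
  moreover have "real r \<ge> 1" using assms(1) by simp
  ultimately show ?thesis unfolding p by (simp add: algebra_simps)
qed

text \<open>The upper inequalities telescope. Only those of index at most j enter, so the bound is
  available inside inductions over the coordinates.\<close>

lemma upper_slack_bound:
  assumes "\<And>k. k \<le> j \<Longrightarrow> 0 \<le> slack e r k True x"
  shows "x j \<le> (real e + 1) * (real r + 1) ^ j - 1"
  using assms
proof (induction j)
  case 0
  then show ?case by (auto simp: slack_def dest: spec[of _ 0])
next
  case (Suc j)
  have "x j \<le> (real e + 1) * (real r + 1) ^ j - 1" using Suc by simp
  with Suc.prems[of "Suc j"] show ?case by (simp add: slack_def algebra_simps)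
qed

text \<open>The sum of the two slacks is the length of the interval for \<open>x j\<close>, in which
  \<open>x j\<close> itself cancels. So if one slack is 0, the other is at least 1.\<close>

lemma slack_gap:
  assumes "r \<ge> 1" "j \<ge> 1" "\<And>k. k < j \<Longrightarrow> 0 \<le> slack e r k True x"
  shows "1 \<le> slack e r j b x + slack e r j (\<not> b) x"
proof -
  have "real r * (\<Sum>k<j. x k) + 1 \<le> (real e + 1) * real r * (real r + 1) ^ (j - 1) + x (j - 1)"
    using assms by (intro lower_plus_1_le_upper upper_slack_bound) auto
  then show ?thesis using assms(2) by (cases b) (auto simp: slack_def)
qed

lemma slack_0_sum: "slack e r 0 b x + slack e r 0 (\<not> b) x = real e"
  by (cases b) (auto simp: slack_def)

subsection \<open>Vertices and edge directions\<close>

text \<open>For e = 0 coordinate 0 is fixed, and S and S \<union> {0} give the same point;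
  restricting S to these indices makes it determined by its vertex.\<close>

definition free_indices :: "nat \<Rightarrow> nat \<Rightarrow> nat set" where
  "free_indices n e = {i. i \<le> n \<and> (0 < i \<or> 0 < e)}"

abbreviation real_vertex :: "nat \<Rightarrow> nat \<Rightarrow> nat \<Rightarrow> nat set \<Rightarrow> nat \<Rightarrow> real" where
  "real_vertex n e r S \<equiv> real_vec (vertex n e r S)"

text \<open>
  The primitive direction of the edge at \<open>\<mu>(S)\<close> that leaves the bound on coordinate \<open>i\<close>, oriented so
  that this coordinate increases; coordinates \<open>> n\<close> are cut off only where a vector is formed.
\<close>

function edge_dir :: "nat \<Rightarrow> nat set \<Rightarrow> nat \<Rightarrow> nat \<Rightarrow> int" where
  "edge_dir r S i j =
     (if j < i then 0 else if j = i then 1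
      else if j \<in> S then edge_dir r S i (j - 1)
      else int r * (\<Sum>k<j. edge_dir r S i k))"
  by auto
termination by (relation "Wellfounded.measure (\<lambda>(r, S, i, j). j)") auto

declare edge_dir.simps [simp del]

lemma edge_dir_below: "j < i \<Longrightarrow> edge_dir r S i j = 0"
  and edge_dir_self: "edge_dir r S i i = 1"
  and edge_dir_upper: "i < j \<Longrightarrow> j \<in> S \<Longrightarrow> edge_dir r S i j = edge_dir r S i (j - 1)"
  and edge_dir_lower: "i < j \<Longrightarrow> j \<notin> S \<Longrightarrow> edge_dir r S i j = int r * (\<Sum>k<j. edge_dir r S i k)"
  by (subst edge_dir.simps, simp)+

lemmas edge_dir_rec = edge_dir_below edge_dir_self edge_dir_upper edge_dir_lower

definition real_edge_dir :: "nat \<Rightarrow> nat \<Rightarrow> nat set \<Rightarrow> nat \<Rightarrow> nat \<Rightarrow> real" where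
  "real_edge_dir n r S i = (\<lambda>j. if j \<le> n then real_of_int (edge_dir r S i j) else 0)"

lemma vertex_seq_0: "vertex_seq e r S 0 = (if 0 \<in> S then int e else 0)"
  and vertex_seq_upper: "0 < j \<Longrightarrow> j \<in> S \<Longrightarrow>
    vertex_seq e r S j = (int e + 1) * int r * (int r + 1) ^ (j - 1) + vertex_seq e r S (j - 1)"
  and vertex_seq_lower: "0 < j \<Longrightarrow> j \<notin> S \<Longrightarrow>
    vertex_seq e r S j = int r * (\<Sum>k<j. vertex_seq e r S k)"
  by (subst vertex_seq.simps, simp)+

lemmas vertex_seq_rec = vertex_seq_0 vertex_seq_upper vertex_seq_lower

lemma real_vertex_le: "j \<le> n \<Longrightarrow> real_vertex n e r S j = real_of_int (vertex_seq e r S j)"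
  and real_vertex_gt: "n < j \<Longrightarrow> real_vertex n e r S j = 0"
  by (simp_all add: real_vec_def vertex_def)

lemma slack_tight_real_vertex:
  assumes "j \<le> n" shows "slack e r j (j \<in> S) (real_vertex n e r S) = 0"
  using assms by (cases "j = 0"; cases "j \<in> S") (simp_all add: slack_def real_vertex_le vertex_seq_rec)

text \<open>By induction the earlier inequalities hold, so the interval for coordinate j is
  nonempty; a point at one of its ends satisfies the other bound too.\<close>

lemma slack_nonneg_if_tight:
  assumes "r \<ge> 1" "j \<le> n" and tight: "\<And>k. k \<le> n \<Longrightarrow> slack e r k (k \<in> S) x = 0"
  shows "0 \<le> slack e r j b x"
  using \<open>j \<le> n\<close>
proof (induction j arbitrary: b rule: less_induct)
  case (less j)
  have "0 \<le> slack e r j b x + slack e r j (\<not> b) x"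
  proof (cases "j = 0")
    case False
    have "1 \<le> slack e r j b x + slack e r j (\<not> b) x"
      using less False by (intro slack_gap \<open>r \<ge> 1\<close>) auto
    then show ?thesis by simp
  qed (use slack_0_sum[of e r b x] in simp)
  then show ?case using tight[OF less.prems] by (cases "b = (j \<in> S)") auto
qed

lemma real_vertex_in_polyP: "r \<ge> 1 \<Longrightarrow> real_vertex n e r S \<in> polyP n e r"
  unfolding polyP_iff_slack
  using slack_nonneg_if_tight[OF _ _ slack_tight_real_vertex] real_vertex_gt by blast

lemma slack_loose_real_vertex:
  assumes "r \<ge> 1" "j \<in> free_indices n e"
  shows "1 \<le> slack e r j (j \<notin> S) (real_vertex n e r S)"
proof -
  have j: "j \<le> n" using assms by (auto simp: free_indices_def)
  have "1 \<le> slack e r j (j \<in> S) (real_vertex n e r S) + slack e r j (j \<notin> S) (real_vertex n e r S)"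
  proof (cases "j = 0")
    case True
    then show ?thesis using assms slack_0_sum[of e r "0 \<in> S" "real_vertex n e r S"]
      by (auto simp: free_indices_def)
  next
    case False
    then show ?thesis using real_vertex_in_polyP[OF assms(1)] j
      by (intro slack_gap assms(1)) (auto simp: polyP_iff_slack)
  qed
  then show ?thesis using slack_tight_real_vertex[OF j] by simp
qed

text \<open>Each slack is \<plusminus>\<open>x j\<close> plus a function of earlier coordinates, so
  a point can be recovered from one slack per coordinate, going upwards.\<close>

lemma eq_if_same_slack:
  assumes "\<And>k. k < j \<Longrightarrow> x k = y k" "slack e r j b x = slack e r j b y"
  shows "x j = y j"
proof -
  have "(\<Sum>k<j. x k) = (\<Sum>k<j. y k)" using assms(1) by simp
  moreover have "j > 0 \<Longrightarrow> x (j - 1) = y (j - 1)" using assms(1) by simp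
  ultimately show ?thesis using assms(2) by (auto simp: slack_def split: if_splits)
qed

lemma slack_0_eq_0_iff: "e = 0 \<Longrightarrow> slack e r 0 b x = 0 \<longleftrightarrow> x 0 = 0"
  by (auto simp: slack_def)

lemma eq_real_vertex_if_tight:
  assumes "\<And>j. j \<le> n \<Longrightarrow> slack e r j (j \<in> S) x = 0" "\<And>j. j > n \<Longrightarrow> x j = 0"
  shows "x = real_vertex n e r S"
proof
  fix j
  show "x j = real_vertex n e r S j"
  proof (induction j rule: less_induct)
    case (less j)
    show ?case
    proof (cases "j \<le> n")
      case True
      show ?thesis
        by (rule eq_if_same_slack[where e = e and r = r and b = "j \<in> S", OF less])
           (use assms(1) slack_tight_real_vertex True in auto)
    qed (use assms(2) in \<open>auto simp: real_vec_def vertex_def\<close>)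
  qed
qed

text \<open>For an index in only one of the two sets, the same slack would be 0 at one vertex and at
  least 1 at the other.\<close>

lemma real_vertex_eq_iff:
  assumes "r \<ge> 1" "S \<subseteq> free_indices n e" "S' \<subseteq> free_indices n e"
  shows "real_vertex n e r S = real_vertex n e r S' \<longleftrightarrow> S = S'"
proof
  assume eq: "real_vertex n e r S = real_vertex n e r S'"
  have "j \<in> S \<longleftrightarrow> j \<in> S'" if "j \<in> free_indices n e" for j
    using slack_loose_real_vertex[OF assms(1) that, of S] slack_tight_real_vertex[of j n e r S'] eq that
    by (cases "j \<in> S"; cases "j \<in> S'") (auto simp: free_indices_def)
  then show "S = S'" using assms by blast
qed auto

lemma real_vec_eq_iff: "real_vec u = real_vec v \<longleftrightarrow> u = v"
  by (auto simp: real_vec_def fun_eq_iff)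

lemma vertex_eq_iff:
  assumes "r \<ge> 1" "S \<subseteq> free_indices n e" "S' \<subseteq> free_indices n e"
  shows "vertex n e r S = vertex n e r S' \<longleftrightarrow> S = S'"
  using real_vertex_eq_iff[OF assms] by (simp add: real_vec_eq_iff)


section \<open>Moving along an edge direction\<close>

text \<open>\<open>edge_dir\<close> solves the homogeneous form of the equations that hold on the
  facets of S with index above i, hence those slacks do not change. The opposite slacks above i may
  change, which is why \<open>b\<close> is restricted there.\<close>

lemma slack_add_dir:
  assumes "j \<le> n" "i < j \<Longrightarrow> b = (j \<in> S)"
  shows "slack e r j b (x + s *\<^sub>R real_edge_dir n r S i) =
    slack e r j b x + (if j = i then if b then - s else s else 0)"
proof -
  have y: "(s *\<^sub>R real_edge_dir n r S i) k = s * real_of_int (edge_dir r S i k)" if "k \<le> j" for k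
    using that assms by (simp add: scaleR_fun_def real_edge_dir_def)
  then have sum_y: "(\<Sum>k<j. x k + (s *\<^sub>R real_edge_dir n r S i) k) =
      (\<Sum>k<j. x k) + s * real_of_int (\<Sum>k<j. edge_dir r S i k)"
    by (simp add: sum.distrib sum_distrib_left)
  have 0: "(\<Sum>k<j. edge_dir r S i k) = 0" if "j \<le> i"
    using that by (intro sum.neutral) (auto simp: edge_dir_below)
  have below1: "edge_dir r S i (j - 1) = 0" if "j \<le> i" "0 < j"
    using that by (intro edge_dir_below) auto
  consider "j < i" | "j = i" | "i < j" "b = (j \<in> S)"
    using assms(2) by linarith
  then show ?thesis
  proof cases
    case 1
    with 0 below1 show ?thesis
      by (simp add: slack_def y sum_y edge_dir_rec)
  next
    case 2
    have "(s *\<^sub>R real_edge_dir n r S i) j = s" using y[of j] 2 by (simp add: edge_dir_self)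
    moreover have "(s *\<^sub>R real_edge_dir n r S i) (j - 1) = 0" if "j \<noteq> 0"
      using y[of "j - 1"] below1 2 that by simp
    moreover have "(\<Sum>k<j. x k + (s *\<^sub>R real_edge_dir n r S i) k) = (\<Sum>k<j. x k)"
      by (subst sum_y, subst 0) (use 2 in auto)
    ultimately show ?thesis
      using 2 by (cases "j = 0") (simp_all add: slack_def)
  next
    case 3
    then show ?thesis
      by (cases "j \<in> S") (simp_all add: slack_def y[of j] y[of "j - Suc 0"] sum_y edge_dir_rec
          del: of_int_sum, simp_all add: algebra_simps)
  qed
qed

text \<open>Only the slacks at i limit the step: below i nothing moves, and above i the S-slack
  stays 0, so that the opposite one is positive by \<open>slack_gap\<close>.\<close>

lemma perturb_in_polyP:
  assumes "r \<ge> 1" "x \<in> polyP n e r" "i \<le> n"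
    and s: "\<bar>s\<bar> \<le> slack e r i True x" "\<bar>s\<bar> \<le> slack e r i False x"
    and tight: "\<And>j. i < j \<Longrightarrow> j \<le> n \<Longrightarrow> slack e r j (j \<in> S) x = 0"
  shows "x + s *\<^sub>R real_edge_dir n r S i \<in> polyP n e r"
proof -
  define y where "y = x + s *\<^sub>R real_edge_dir n r S i"
  have x: "0 \<le> slack e r j b x" if "j \<le> n" for j b
    using assms(2) that by (auto simp: polyP_iff_slack)
  have "0 \<le> slack e r j b y" if "j \<le> n" for j b
    using that
  proof (induction j arbitrary: b rule: less_induct)
    case (less j)
    consider "j < i" | "j = i" | "i < j" by linarith
    then show ?case
    proof cases
      case 1
      then show ?thesis
        using x[OF less.prems] unfolding y_def by (subst slack_add_dir[OF less.prems]) auto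
    next
      case 2
      then show ?thesis
        using s unfolding y_def by (subst slack_add_dir[OF less.prems]) auto
    next
      case 3
      then have t: "slack e r j (j \<in> S) y = 0"
        using tight[OF 3 less.prems] 3 unfolding y_def by (subst slack_add_dir[OF less.prems]) auto
      have "1 \<le> slack e r j b y + slack e r j (\<not> b) y"
      proof (rule slack_gap[OF assms(1)])
        show "0 \<le> slack e r k True y" if "k < j" for k
          using that less.prems by (intro less.IH) auto
      qed (use 3 in simp)
      then show ?thesis using t by (cases "b = (j \<in> S)") auto
    qed
  qed
  moreover have "y j = 0" if "j > n" for j
    using that assms(2) by (simp add: polyP_iff_slack real_edge_dir_def scaleR_fun_def y_def)
  ultimately show ?thesis unfolding polyP_iff_slack y_def by blast
qed

lemma real_edge_dir_self: "i \<le> n \<Longrightarrow> real_edge_dir n r S i i = 1"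
  by (simp add: real_edge_dir_def edge_dir_rec)

lemma real_edge_dir_below: "j < i \<Longrightarrow> real_edge_dir n r S i j = 0"
  by (simp add: real_edge_dir_def edge_dir_rec)

text \<open>This serves both classifications below: it refutes extremality of a point strictly
  between its bounds at i, and it produces a direction in which a face must extend.\<close>

lemma perturbation:
  assumes "r \<ge> 1" "x \<in> polyP n e r" "i \<le> n" "\<And>b. 0 < slack e r i b x"
    and "\<And>j. i < j \<Longrightarrow> j \<le> n \<Longrightarrow> slack e r j (j \<in> S) x = 0"
  obtains s where "0 < s" "x + s *\<^sub>R real_edge_dir n r S i \<in> polyP n e r"
    "x - s *\<^sub>R real_edge_dir n r S i \<in> polyP n e r"
    "x \<in> open_segment (x + s *\<^sub>R real_edge_dir n r S i) (x - s *\<^sub>R real_edge_dir n r S i)"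
proof -
  define s where "s = min (slack e r i True x) (slack e r i False x)"
  have s: "0 < s" using assms(4) by (auto simp: s_def)
  have "x + t *\<^sub>R real_edge_dir n r S i \<in> polyP n e r" if "\<bar>t\<bar> = s" for t
    using that by (intro perturb_in_polyP assms(1,2,3,5)) (auto simp: s_def)
  from this[of s] this[of "-s"] have 1: "x + s *\<^sub>R real_edge_dir n r S i \<in> polyP n e r"
    "x - s *\<^sub>R real_edge_dir n r S i \<in> polyP n e r" using s by auto
  have "x + s *\<^sub>R real_edge_dir n r S i \<noteq> x - s *\<^sub>R real_edge_dir n r S i"
    using fun_cong[of "x + s *\<^sub>R real_edge_dir n r S i" "x - s *\<^sub>R real_edge_dir n r S i" i] s
    by (auto simp: scaleR_fun_def real_edge_dir_self[OF assms(3)])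
  moreover have "x = (1 - 1/2) *\<^sub>R (x + s *\<^sub>R real_edge_dir n r S i) + (1/2) *\<^sub>R (x - s *\<^sub>R real_edge_dir n r S i)"
    by (simp add: algebra_simps flip: scaleR_add_left)
  ultimately have "x \<in> open_segment (x + s *\<^sub>R real_edge_dir n r S i) (x - s *\<^sub>R real_edge_dir n r S i)"
    unfolding in_segment by (intro conjI exI[of _ "1/2"]) auto
  with s 1 that show ?thesis by blast
qed

section \<open>The extreme points are exactly the \<mu>(S)\<close>

lemma slack_zero_open_segment:
  assumes "a \<in> polyP n e r" "c \<in> polyP n e r" "x \<in> open_segment a c" "j \<le> n" "slack e r j b x = 0"
  shows "slack e r j b a = 0" "slack e r j b c = 0"
proof -
  obtain u where u: "0 < u" "u < 1" "x = (1 - u) *\<^sub>R a + u *\<^sub>R c"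
    using assms(3) unfolding in_segment by blast
  have "0 \<le> slack e r j b a" "0 \<le> slack e r j b c"
    using assms(1,2,4) by (auto simp: polyP_iff_slack)
  moreover have "(1 - u) * slack e r j b a + u * slack e r j b c = 0"
    using assms(5) unfolding u(3) slack_convex .
  ultimately show "slack e r j b a = 0" "slack e r j b c = 0"
    using u(1,2) by (simp_all add: add_nonneg_eq_0_iff)
qed

lemma real_vertex_extreme:
  assumes "r \<ge> 1"
  shows "real_vertex n e r S extreme_point_of polyP n e r"
  unfolding extreme_point_of_def
proof (intro conjI ballI notI real_vertex_in_polyP assms)
  fix a c assume *: "a \<in> polyP n e r" "c \<in> polyP n e r" "real_vertex n e r S \<in> open_segment a c"
  have "a = real_vertex n e r S" "c = real_vertex n e r S"
    using * slack_zero_open_segment[OF *] slack_tight_real_vertex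
    by (auto intro!: eq_real_vertex_if_tight simp: polyP_iff_slack)
  then show False using *(3) by (auto simp: open_segment_def)
qed

lemma extreme_is_real_vertex:
  assumes "r \<ge> 1" "x extreme_point_of polyP n e r"
  obtains S where "S \<subseteq> free_indices n e" "x = real_vertex n e r S"
proof -
  have x: "x \<in> polyP n e r" using assms by (simp add: extreme_point_of_def)
  define T where "T = {j. slack e r j True x = 0}"
  define B where "B = {i. i \<le> n \<and> (\<forall>b. 0 < slack e r i b x)}"
  have "B = {}"
  proof (rule ccontr)
    assume "B \<noteq> {}"
    moreover have "finite B" by (simp add: B_def)
    \<comment> \<open>The largest index at which neither bound is attained: all later coordinates
      sit at a bound, as \<open>perturbation\<close> requires.\<close>
    ultimately obtain i where "i \<in> B" and mx: "\<And>j. i < j \<Longrightarrow> j \<notin> B"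
      by (metis Max_in Max_ge linorder_not_less)
    then have i: "i \<le> n" "\<And>b. 0 < slack e r i b x" by (auto simp: B_def)
    have tight: "slack e r j (j \<in> T) x = 0" if j: "i < j" "j \<le> n" for j
    proof -
      obtain b where "\<not> 0 < slack e r j b x" using mx[OF j(1)] j(2) by (auto simp: B_def)
      then have "slack e r j b x = 0" using x j(2) by (meson polyP_iff_slack order_antisym_conv linorder_not_less)
      then show ?thesis unfolding T_def by (cases b; cases "slack e r j True x = 0") auto
    qed
    obtain s where "x + s *\<^sub>R real_edge_dir n r T i \<in> polyP n e r"
       "x - s *\<^sub>R real_edge_dir n r T i \<in> polyP n e r"
       "x \<in> open_segment (x + s *\<^sub>R real_edge_dir n r T i) (x - s *\<^sub>R real_edge_dir n r T i)"
      by (rule perturbation[OF assms(1) x i tight])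
    then show False using assms(2) by (auto simp: extreme_point_of_def)
  qed
  \<comment> \<open>For e = 0 the intersection may remove 0 from T; this is harmless, since both
    slacks of coordinate 0 vanish.\<close>
  have "slack e r j (j \<in> T \<inter> free_indices n e) x = 0" if j: "j \<le> n" for j
  proof -
    obtain b where "\<not> 0 < slack e r j b x" using j \<open>B = {}\<close> by (auto simp: B_def)
    then have b: "slack e r j b x = 0" using x that by (meson polyP_iff_slack order_antisym_conv linorder_not_less)
    show ?thesis
    proof (cases "j \<in> free_indices n e")
      case True
      then show ?thesis using b unfolding T_def by (cases b; cases "slack e r j True x = 0") auto
    next
      case False
      then have "j = 0" "e = 0" using that by (auto simp: free_indices_def)
      then show ?thesis using b by (auto simp: slack_0_eq_0_iff)
    qed
  qed
  then have "x = real_vertex n e r (T \<inter> free_indices n e)"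
    using x by (intro eq_real_vertex_if_tight) (auto simp: polyP_iff_slack)
  then show ?thesis using that by blast
qed

subsection \<open>Faces that are segments between vertices\<close>

lemma edge_face:
  assumes "r \<ge> 1" "i \<in> free_indices n e" and S': "S' = sym_diff S {i}"
  shows "closed_segment (real_vertex n e r S) (real_vertex n e r S') face_of polyP n e r"
proof -
  have i: "i \<le> n" using assms by (auto simp: free_indices_def)
  \<comment> \<open>The facets of S other than the one at i cut out this face; it remains to
    identify it with the segment.\<close>
  define F where "F = {x \<in> polyP n e r. \<forall>j\<le>n. j \<noteq> i \<longrightarrow> slack e r j (j \<in> S) x = 0}"
  have iff: "j \<in> S' \<longleftrightarrow> j \<in> S" if "j \<noteq> i" for j using that S' by auto
  have seg: "closed_segment (real_vertex n e r S) (real_vertex n e r S') \<subseteq> F"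
  proof
    fix x assume "x \<in> closed_segment (real_vertex n e r S) (real_vertex n e r S')"
    then obtain u where u: "0 \<le> u" "u \<le> 1" "x = (1 - u) *\<^sub>R real_vertex n e r S + u *\<^sub>R real_vertex n e r S'"
      unfolding in_segment by blast
    have "0 \<le> slack e r j b x" if "j \<le> n" for j b
      unfolding u(3) slack_convex using u(1,2) that real_vertex_in_polyP[OF assms(1), of n e]
      by (intro add_nonneg_nonneg mult_nonneg_nonneg) (auto simp: polyP_iff_slack)
    moreover have "slack e r j (j \<in> S) x = 0" if "j \<le> n" "j \<noteq> i" for j
      unfolding u(3) slack_convex
      using slack_tight_real_vertex[OF that(1), of e r S] slack_tight_real_vertex[OF that(1), of e r S'] iff[OF that(2)]
      by simp
    ultimately show "x \<in> F"
      unfolding F_def polyP_iff_slack by (auto simp: u(3) scaleR_fun_def real_vec_def vertex_def)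
  qed
  moreover have "F \<subseteq> closed_segment (real_vertex n e r S) (real_vertex n e r S')"
  proof
    fix x assume x: "x \<in> F"
    define g where "g = slack e r i (i \<in> S) (real_vertex n e r S')"
    have g: "1 \<le> g" using slack_loose_real_vertex[OF assms(1,2), of S'] S' by (auto simp: g_def)
    \<comment> \<open>The slack at i is affine along the segment, 0 at \<mu>(S) and g at \<mu>(S'),
      so u is the only possible parameter of x. That u \<le> 1 will follow from the opposite slack
      at i, which is 0 at \<mu>(S').\<close>
    define u where "u = slack e r i (i \<in> S) x / g"
    let ?y = "(1 - u) *\<^sub>R real_vertex n e r S + u *\<^sub>R real_vertex n e r S'"
    have ti: "slack e r i (i \<in> S) ?y = slack e r i (i \<in> S) x"
      unfolding slack_convex using slack_tight_real_vertex[OF i, of e r S] g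
      by (simp add: u_def g_def)
    have tj: "slack e r j (j \<in> S) ?y = slack e r j (j \<in> S) x" if "j \<le> n" "j \<noteq> i" for j
      unfolding slack_convex
      using slack_tight_real_vertex[OF that(1), of e r S] slack_tight_real_vertex[OF that(1), of e r S'] iff[OF that(2)]
        x that by (simp add: F_def)
    have xy: "x j = ?y j" for j
    proof (induction j rule: less_induct)
      case (less j)
      show ?case
      proof (cases "j \<le> n")
        case True
        show ?thesis using ti tj[OF True]
          by (intro eq_if_same_slack[of j x ?y e r "j \<in> S", OF less]) (cases "j = i"; simp only:)+
      next
        case False
        then show ?thesis using x
          by (simp add: F_def polyP_iff_slack scaleR_fun_def real_vec_def vertex_def)
      qed
    qed
    have "0 \<le> slack e r i (i \<in> S) x" "0 \<le> slack e r i (i \<notin> S) x"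
      using x i by (auto simp: F_def polyP_iff_slack)
    moreover have "slack e r i (i \<notin> S) ?y = slack e r i (i \<notin> S) x"
      using xy by presburger
    moreover have "slack e r i (i \<notin> S) ?y = (1 - u) * slack e r i (i \<notin> S) (real_vertex n e r S)"
      unfolding slack_convex using slack_tight_real_vertex[OF i, of e r S'] S' by auto
    moreover have "1 \<le> slack e r i (i \<notin> S) (real_vertex n e r S)"
      by (rule slack_loose_real_vertex[OF assms(1,2)])
    ultimately have "0 \<le> u" "u \<le> 1"
      using g by (auto simp: u_def zero_le_mult_iff)
    moreover have "x = ?y" using xy by blast
    ultimately show "x \<in> closed_segment (real_vertex n e r S) (real_vertex n e r S')"
      unfolding in_segment by blast
  qed
  moreover have "\<forall>a\<in>polyP n e r. \<forall>c\<in>polyP n e r. \<forall>x\<in>F. x \<in> open_segment a c \<longrightarrow> a \<in> F \<and> c \<in> F"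
    using slack_zero_open_segment by (auto simp: F_def)
  moreover have "F \<subseteq> polyP n e r" by (auto simp: F_def)
  ultimately show ?thesis
    unfolding face_of_def by (metis convex_closed_segment subset_antisym)
qed

text \<open>The midpoint of the segment can be moved along the edge direction of the largest index i
  at which the sets differ, and the face property keeps it in the segment. That direction vanishes
  below i, whereas the segment moves at the smallest index of difference; so the two indices
  agree.\<close>

lemma edge_only_flip:
  assumes r: "r \<ge> 1" and S: "S \<subseteq> free_indices n e" "S' \<subseteq> free_indices n e" "S \<noteq> S'"
    and face: "closed_segment (real_vertex n e r S) (real_vertex n e r S') face_of polyP n e r"
  obtains i where "i \<in> free_indices n e" "S' = sym_diff S {i}"
proof -
  let ?v = "real_vertex n e r S" and ?v' = "real_vertex n e r S'"
  define D where "D = sym_diff S S'"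
  have D: "D \<subseteq> free_indices n e" "finite D" "D \<noteq> {}"
    using S by (auto simp: D_def free_indices_def intro: finite_subset[of _ "{..n}"])
  define i where "i = Max D"
  have i: "i \<in> D" "\<And>j. i < j \<Longrightarrow> j \<notin> D" using D by (auto simp: i_def)
  have in': "i \<le> n" using i D by (auto simp: free_indices_def)
  have iff: "j \<in> S' \<longleftrightarrow> j \<in> S" if "j \<notin> D" for j using that by (auto simp: D_def)
  have niff: "j \<in> S' \<longleftrightarrow> j \<notin> S" if "j \<in> D" for j using that by (auto simp: D_def)
  define x where "x = (1 - 1/2) *\<^sub>R ?v + (1/2) *\<^sub>R ?v'"
  have xm: "x \<in> closed_segment ?v ?v'"
    unfolding in_segment x_def by (intro conjI exI[of _ "1/2"]) auto
  have seg: "closed_segment ?v ?v' \<subseteq> polyP n e r" using face by (simp add: face_of_def)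
  have xP: "x \<in> polyP n e r" using xm seg by blast
  have "0 < slack e r i b x" for b
  proof -
    have "0 \<le> slack e r i b ?v" "0 \<le> slack e r i b ?v'"
      using real_vertex_in_polyP[OF r] in' by (auto simp: polyP_iff_slack)
    moreover have "1 \<le> slack e r i (i \<notin> S) ?v" "1 \<le> slack e r i (i \<notin> S') ?v'"
      using i D by (auto intro!: slack_loose_real_vertex[OF r])
    ultimately show ?thesis
      unfolding x_def slack_convex using niff[OF i(1)] by (cases "b = (i \<in> S)") auto
  qed
  moreover have "slack e r j (j \<in> S) x = 0" if "i < j" "j \<le> n" for j
    unfolding x_def slack_convex
    using slack_tight_real_vertex[OF that(2), of e r S] slack_tight_real_vertex[OF that(2), of e r S']
      iff[OF i(2)[OF that(1)]] by simp
  ultimately obtain s where s: "0 < s" "x + s *\<^sub>R real_edge_dir n r S i \<in> polyP n e r"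
    "x - s *\<^sub>R real_edge_dir n r S i \<in> polyP n e r"
    "x \<in> open_segment (x + s *\<^sub>R real_edge_dir n r S i) (x - s *\<^sub>R real_edge_dir n r S i)"
    using perturbation[OF r xP in', of S] by blast
  with face xm have "x + s *\<^sub>R real_edge_dir n r S i \<in> closed_segment ?v ?v'"
    unfolding face_of_def by blast
  then obtain u where u: "x + s *\<^sub>R real_edge_dir n r S i = (1 - u) *\<^sub>R ?v + u *\<^sub>R ?v'"
    unfolding in_segment by blast
  have "j = i" if "j \<in> D" for j
  proof (rule ccontr)
    assume "j \<noteq> i"
    define k where "k = Min D"
    have k: "k \<in> D" "\<And>j. j < k \<Longrightarrow> j \<notin> D" using D by (auto simp: k_def)
    have "k < i" using \<open>j \<noteq> i\<close> that D(2) i k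
      by (metis Min_le i_def k_def le_neq_implies_less Max_ge order.trans order_antisym)
    have eqk: "?v j = ?v' j" if "j < k" for j
      using that
    proof (induction j rule: less_induct)
      case (less j)
      have "j \<le> n" using less.prems \<open>k < i\<close> in' by simp
      show ?case
      proof (rule eq_if_same_slack)
        show "?v l = ?v' l" if "l < j" for l
          using less.IH[OF that] that less.prems by simp
        show "slack e r j (j \<in> S) ?v = slack e r j (j \<in> S) ?v'"
          using slack_tight_real_vertex[OF \<open>j \<le> n\<close>, of e r S] slack_tight_real_vertex[OF \<open>j \<le> n\<close>, of e r S']
          by (simp only: iff[OF k(2)[OF less.prems]])
      qed
    qed
    have "?v k \<noteq> ?v' k"
    proof
      assume "?v k = ?v' k"
      then have eq: "?v j = ?v' j" if "j \<le> k" for j using eqk that by (cases "j = k") auto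
      then have "(\<Sum>j<k. ?v j) = (\<Sum>j<k. ?v' j)" by simp
      then have "slack e r k (k \<in> S) ?v = slack e r k (k \<in> S) ?v'"
        using eq[of 0] eq[of "k - 1"] eq[of k] by (simp add: slack_def)
      moreover have "1 \<le> slack e r k (k \<notin> S') ?v'"
        using k D by (auto intro!: slack_loose_real_vertex[OF r])
      moreover have "slack e r k (k \<in> S) ?v = 0"
        using k D by (auto intro!: slack_tight_real_vertex simp: free_indices_def)
      ultimately show False using niff[OF k(1)] by auto
    qed
    moreover have "x k = (1 - u) * ?v k + u * ?v' k"
      using fun_cong[OF u, of k] real_edge_dir_below[OF \<open>k < i\<close>] by (simp add: scaleR_fun_def)
    then have "(2 * u - 1) * (?v' k - ?v k) = 0"
      unfolding x_def by (simp add: scaleR_fun_def field_simps)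
    \<comment> \<open>Coordinate k is unchanged by the perturbation but not constant on the segment,
      so the perturbed point would still be the midpoint.\<close>
    ultimately have "u = 1/2" by simp
    have "x + s *\<^sub>R real_edge_dir n r S i = x" using u unfolding \<open>u = 1/2\<close> x_def[symmetric] .
    then have "s *\<^sub>R real_edge_dir n r S i = 0" by (simp del: scaleR_eq_0_iff)
    from fun_cong[OF this, of i] show False using s(1) real_edge_dir_self[OF in'] by (simp add: scaleR_fun_def)
  qed
  then have "D = {i}" using i by blast
  then have "S' = sym_diff S {i}" unfolding D_def by blast
  then show ?thesis using that[of i] i(1) D(1) by auto
qed

lemma neighbours_eq:
  assumes r: "r \<ge> 1" and S: "S \<subseteq> free_indices n e"
  shows "neighbours (polyP n e r) (vertex n e r S) = (\<lambda>i. vertex n e r (sym_diff S {i})) ` free_indices n e"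
proof (intro equalityI subsetI)
  fix v assume v: "v \<in> neighbours (polyP n e r) (vertex n e r S)"
  then obtain S' where S': "S' \<subseteq> free_indices n e" "real_vec v = real_vertex n e r S'"
    by (auto simp: neighbours_def elim: extreme_is_real_vertex[OF r])
  then have v': "v = vertex n e r S'" by (simp add: real_vec_eq_iff)
  have "S \<noteq> S'" using v v' by (auto simp: neighbours_def)
  moreover have "closed_segment (real_vertex n e r S) (real_vertex n e r S') face_of polyP n e r"
    using v v' by (simp add: neighbours_def)
  ultimately obtain i where "i \<in> free_indices n e" "S' = sym_diff S {i}"
    using edge_only_flip[OF r S S'(1)] by blast
  then show "v \<in> (\<lambda>i. vertex n e r (sym_diff S {i})) ` free_indices n e" using v' by blast
next
  fix v assume "v \<in> (\<lambda>i. vertex n e r (sym_diff S {i})) ` free_indices n e"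
  then obtain i where i: "i \<in> free_indices n e" "v = vertex n e r (sym_diff S {i})" by blast
  have "vertex n e r (sym_diff S {i}) \<noteq> vertex n e r S"
    using i S by (subst vertex_eq_iff[OF r]) auto
  then show "v \<in> neighbours (polyP n e r) (vertex n e r S)"
    unfolding neighbours_def i(2) using i by (auto intro!: real_vertex_extreme[OF r] edge_face[OF r i(1) refl])
qed

section \<open>Primitive edge vectors and their coordinate sums\<close>

lemma coord_sum_primitive_dir:
  assumes r: "r \<ge> 1" and i: "i \<in> free_indices n e"
  shows "coord_sum n (primitive_dir (vertex n e r S) (vertex n e r (sym_diff S {i}))) =
     (if i \<in> S then -1 else 1) * (\<Sum>j\<le>n. edge_dir r S i j)"
proof -
  have in': "i \<le> n" using i by (auto simp: free_indices_def)
  define S' where "S' = sym_diff S {i}"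
  define d where "d j = (if j \<le> n then edge_dir r S i j else 0)" for j
  define g where "g = vertex n e r S' i - vertex n e r S i"
  \<comment> \<open>Beyond i both vertices obey the same affine recursion, so their difference obeys
    its homogeneous form, as \<open>edge_dir\<close> does, with start value g instead of 1.\<close>
  have eq: "vertex n e r S' j - vertex n e r S j = g * d j" for j
  proof (induction j rule: less_induct)
    case (less j)
    consider "j > n" | "j \<le> n" "j < i" | "j = i" | "j \<le> n" "i < j" by linarith
    then show ?case
    proof cases
      case 1
      then show ?thesis by (simp add: vertex_def d_def)
    next
      case 4
      have *: "vertex_seq e r S' k - vertex_seq e r S k = g * edge_dir r S i k" if "k < j" for k
        using less.IH[OF that] that 4 by (simp add: vertex_def d_def)
      have "(\<Sum>k<j. vertex_seq e r S' k) - (\<Sum>k<j. vertex_seq e r S k) = g * (\<Sum>k<j. edge_dir r S i k)"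
        by (simp add: sum_distrib_left * flip: sum_subtractf)
      moreover have "j \<in> S' \<longleftrightarrow> j \<in> S" using 4 by (auto simp: S'_def)
      ultimately show ?thesis using 4 *[of "j - 1"]
        by (simp add: vertex_def d_def vertex_seq.simps[of _ _ _ j] edge_dir_rec)
           (simp add: algebra_simps)
    next
      case 2
      have *: "vertex_seq e r S' k = vertex_seq e r S k" if "k < j" for k
        using less.IH[OF that] that 2 by (simp add: vertex_def d_def edge_dir_rec)
      then have "(\<Sum>k<j. vertex_seq e r S' k) = (\<Sum>k<j. vertex_seq e r S k)"
        by simp
      moreover have "j \<in> S' \<longleftrightarrow> j \<in> S" using 2 by (auto simp: S'_def)
      ultimately show ?thesis using 2 *[of "j - 1"]
        by (auto simp: vertex_def d_def vertex_seq.simps[of _ _ _ j] edge_dir_rec)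
    next
      case 3
      then show ?thesis using in' by (simp add: g_def d_def edge_dir_rec)
    qed
  qed
  have below: "vertex n e r S' j = vertex n e r S j" if "j < i" for j
    using eq[of j] that by (simp add: d_def edge_dir_rec split: if_splits)
  have g: "if i \<in> S then g < 0 else g > 0"
  proof -
    have "slack e r i (i \<in> S) (real_vertex n e r S') - slack e r i (i \<in> S) (real_vertex n e r S)
        = (if i \<in> S then - real_of_int g else real_of_int g)"
      using below by (simp add: slack_def real_vec_def g_def)
    moreover have "1 \<le> slack e r i (i \<notin> S') (real_vertex n e r S')" by (rule slack_loose_real_vertex[OF r i])
    moreover have "i \<notin> S' \<longleftrightarrow> i \<in> S" by (auto simp: S'_def)
    ultimately show ?thesis using slack_tight_real_vertex[OF in', of e r S] by (auto split: if_splits)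
  qed
  \<comment> \<open>The entry of d at i is 1, so g itself is among the entries.\<close>
  have gcd: "Gcd (range (\<lambda>k. g * d k)) = \<bar>g\<bar>"
  proof (rule zdvd_antisym_nonneg)
    have "g * d i = g" using in' by (simp add: d_def edge_dir_self)
    then have "Gcd (range (\<lambda>k. g * d k)) dvd g"
      by (metis Gcd_dvd rangeI)
    then show "Gcd (range (\<lambda>k. g * d k)) dvd \<bar>g\<bar>" by simp
    show "\<bar>g\<bar> dvd Gcd (range (\<lambda>k. g * d k))"
      by (rule Gcd_greatest) auto
  qed auto
  have "primitive_dir (vertex n e r S) (vertex n e r S') j = (if i \<in> S then -1 else 1) * d j" for j
  proof -
    have "g * d j = \<bar>g\<bar> * ((if i \<in> S then -1 else 1) * d j)"
      using g by (cases "i \<in> S") auto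
    moreover have "\<bar>g\<bar> \<noteq> 0" using g by (auto split: if_splits)
    ultimately show ?thesis
      using gcd unfolding primitive_dir_def eq by (metis nonzero_mult_div_cancel_left)
  qed
  then show ?thesis
    unfolding coord_sum_def S'_def[symmetric]
    by (simp add: d_def sum_negf)
qed

subsection \<open>Powers of \<open>x\<close> and orders of vanishing\<close>

definition X_pow :: "int \<Rightarrow> rat fls" where "X_pow i = fls_X_intpow i"

lemma X_pow_add: "X_pow (i + j) = X_pow i * X_pow j"
  by (simp only: X_pow_def fls_X_intpow_times_fls_X_intpow)

lemma X_pow_0 [simp]: "X_pow 0 = 1"
  by (simp add: X_pow_def)

lemma X_pow_nonzero [simp]: "X_pow i \<noteq> 0"
  by (simp add: X_pow_def)

lemma X_pow_eq_1_iff [simp]: "X_pow i = 1 \<longleftrightarrow> i = 0"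
proof
  assume "X_pow i = 1"
  then have "fls_subdegree (X_pow i) = fls_subdegree (1 :: rat fls)" by simp
  then show "i = 0" by (simp add: X_pow_def)
qed simp

lemma X_pow_minus: "X_pow (- i) = 1 / X_pow i"
  using X_pow_add[of i "- i"] by (simp add: field_simps)

lemma X_pow_of_nat: "X_pow (int d) = fps_to_fls (fps_X ^ d)"
  by (simp add: X_pow_def fps_to_fls_power fls_X_power_conv_shift_1)

lemma geometric_interval:
  assumes "d \<noteq> 0" "L \<le> U + 1"
  shows "(\<Sum>k\<in>{L..U}. X_pow (d * k)) =
    X_pow (d * L) / (1 - X_pow d) + X_pow (d * U) / (1 - X_pow (- d))"
proof -
  define q where "q = X_pow d"
  have q: "q \<noteq> 0" "q \<noteq> 1" using assms by (simp_all add: q_def)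
  have step: "X_pow (d * (k + 1)) = X_pow (d * k) * q" for k
    by (simp add: q_def algebra_simps X_pow_add)
  have "L - 1 \<le> U" using assms by simp
  then have "(\<Sum>k\<in>{L..U}. X_pow (d * k)) = X_pow (d * L) / (1 - q) + X_pow (d * U) / (1 - 1 / q)"
  proof (induction U rule: int_ge_induct)
    case base
    then show ?case using step[of "L - 1"] q by (simp add: field_simps)
  next
    case (step U)
    have "{L..U + 1} = insert (U + 1) {L..U}" using step.hyps by auto
    then have "(\<Sum>k\<in>{L..U + 1}. X_pow (d * k)) =
        X_pow (d * U) * q + (X_pow (d * L) / (1 - q) + X_pow (d * U) / (1 - 1 / q))"
      using step.IH \<open>X_pow (d * (U + 1)) = X_pow (d * U) * q\<close> by simp
    also have "\<dots> = X_pow (d * L) / (1 - q) + (X_pow (d * U) * q) / (1 - 1 / q)"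
      using q by (simp add: divide_simps) (simp add: algebra_simps)
    finally show ?case by (simp add: \<open>X_pow (d * (U + 1)) = X_pow (d * U) * q\<close>)
  qed
  then show ?thesis by (simp add: X_pow_minus q_def)
qed

text \<open>A cofactor instead of \<open>fls_subdegree\<close> lets 0 have every order and makes
  products immediate; the cofactor is a power series, so \<open>f\<close> is one as well.\<close>

definition ord_ge :: "nat \<Rightarrow> rat fls \<Rightarrow> bool" where
  "ord_ge N f \<longleftrightarrow> (\<exists>R. f = X_pow (int N) * fps_to_fls R)"

lemma ord_ge_mult: "ord_ge M f \<Longrightarrow> ord_ge N g \<Longrightarrow> ord_ge (M + N) (f * g)"
proof -
  assume "ord_ge M f" "ord_ge N g"
  then obtain R Q where "f = X_pow (int M) * fps_to_fls R" "g = X_pow (int N) * fps_to_fls Q"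
    unfolding ord_ge_def by blast
  then have "f * g = X_pow (int (M + N)) * fps_to_fls (R * Q)"
    by (simp add: X_pow_add fls_times_fps_to_fls algebra_simps)
  then show ?thesis unfolding ord_ge_def by blast
qed

lemma ord_ge_X_pow: "ord_ge N (X_pow (int N))"
  unfolding ord_ge_def by (intro exI[of _ 1]) simp

lemma ord_ge_mono: "ord_ge N f \<Longrightarrow> M \<le> N \<Longrightarrow> ord_ge M f"
proof -
  assume "ord_ge N f" "M \<le> N"
  then obtain R where "f = X_pow (int N) * fps_to_fls R" unfolding ord_ge_def by blast
  moreover have "X_pow (int N) = X_pow (int M) * X_pow (int (N - M))"
    using \<open>M \<le> N\<close> by (simp flip: X_pow_add)
  ultimately have "f = X_pow (int M) * fps_to_fls (fps_X ^ (N - M) * R)"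
    by (simp add: X_pow_of_nat fls_times_fps_to_fls algebra_simps)
  then show ?thesis unfolding ord_ge_def by blast
qed

lemma ord_ge_sum: "(\<And>i. i \<in> I \<Longrightarrow> ord_ge N (f i)) \<Longrightarrow> ord_ge N (\<Sum>i\<in>I. f i)"
proof (induction I rule: infinite_finite_induct)
  case (insert i I)
  then obtain R Q where "f i = X_pow (int N) * fps_to_fls R" "sum f I = X_pow (int N) * fps_to_fls Q"
    unfolding ord_ge_def by blast
  then have "sum f (insert i I) = X_pow (int N) * fps_to_fls (R + Q)"
    using insert by (simp add: algebra_simps)
  then show ?case unfolding ord_ge_def by blast
qed (auto simp: ord_ge_def intro: exI[of _ 0])

lemma ord_ge_imp_fps:
  assumes "ord_ge N f"
  obtains R where "f = fps_to_fls R" "\<And>k. k < N \<Longrightarrow> fps_nth R k = 0"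
proof -
  obtain R where "f = X_pow (int N) * fps_to_fls R" using assms unfolding ord_ge_def by blast
  then have "f = fps_to_fls (fps_X ^ N * R)" by (simp add: X_pow_of_nat fls_times_fps_to_fls)
  then show ?thesis using that[of "fps_X ^ N * R"] by (simp add: fps_X_power_mult_nth)
qed

lemma ord_ge_geometric: "d > 0 \<Longrightarrow> ord_ge 0 (1 / (1 - X_pow (int d)))"
proof -
  assume d: "d > 0"
  have "(1 - X_pow (int d)) * fps_to_fls (inverse (1 - fps_X ^ d)) =
      fps_to_fls ((1 - fps_X ^ d) * inverse (1 - fps_X ^ d))"
    by (simp add: X_pow_of_nat fls_times_fps_to_fls)
  also have "(1 - fps_X ^ d) * inverse (1 - fps_X ^ d) = (1 :: rat fps)"
    using d by (intro inverse_mult_eq_1') (simp add: fps_X_power_nth)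
  finally have "1 / (1 - X_pow (int d)) = fps_to_fls (inverse (1 - fps_X ^ d))"
    using d by (simp add: field_simps)
  then show ?thesis unfolding ord_ge_def by auto
qed

text \<open>Expanded about 0, 1/(1 - x^(-d)) is -x^d/(1 - x^d); each edge along which a coordinate
  decreases thus adds to the order.\<close>

lemma ord_ge_geometric_neg: "d > 0 \<Longrightarrow> ord_ge d (1 / (1 - X_pow (- int d)))"
proof -
  assume d: "d > 0"
  then have "1 / (1 - X_pow (- int d)) = X_pow (int d) * (- 1) * (1 / (1 - X_pow (int d)))"
    by (simp add: X_pow_minus divide_simps) (simp add: algebra_simps)
  moreover have "ord_ge 0 (- 1)"
    unfolding ord_ge_def by (intro exI[of _ "- 1"]) simp
  ultimately show ?thesis
    using ord_ge_mult[OF ord_ge_mult[OF ord_ge_X_pow[of d]] ord_ge_geometric[OF d]] by fastforce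
qed

subsection \<open>Weighted degrees\<close>

definition wsum :: "nat \<Rightarrow> (nat \<Rightarrow> nat) \<Rightarrow> (nat \<Rightarrow> int) \<Rightarrow> int" where
  "wsum n w v = (\<Sum>j\<le>n. int (w j) * v j)"

text \<open>The linear form left on coordinates 0..n when coordinate n+1 is replaced by its lower
  bound; \<open>upper_weights\<close> does the same for the upper bound, up to a constant.\<close>

definition lower_weights :: "nat \<Rightarrow> nat \<Rightarrow> (nat \<Rightarrow> nat) \<Rightarrow> nat \<Rightarrow> nat" where
  "lower_weights r n w = (\<lambda>j. w j + r * w (Suc n))"

definition upper_weights :: "nat \<Rightarrow> (nat \<Rightarrow> nat) \<Rightarrow> nat \<Rightarrow> nat" where
  "upper_weights n w = w(n := w n + w (Suc n))"

definition step_weights :: "nat \<Rightarrow> nat set \<Rightarrow> nat \<Rightarrow> (nat \<Rightarrow> nat) \<Rightarrow> nat \<Rightarrow> nat" where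
  "step_weights r S n w = (if Suc n \<in> S then upper_weights n w else lower_weights r n w)"

lemma wsum_lower:
  "wsum n (lower_weights r n w) v = wsum n w v + int (w (Suc n)) * (int r * (\<Sum>j\<le>n. v j))"
  by (simp add: wsum_def lower_weights_def sum.distrib sum_distrib_left algebra_simps)

lemma wsum_upper:
  "wsum n (upper_weights n w) v = wsum n w v + int (w (Suc n)) * v n"
proof -
  have "wsum n (upper_weights n w) v = (\<Sum>j<n. int (w j) * v j) + int (w n + w (Suc n)) * v n"
    by (simp add: wsum_def upper_weights_def lessThan_Suc_atMost[symmetric])
  then show ?thesis by (simp add: wsum_def lessThan_Suc_atMost[symmetric] algebra_simps)
qed

lemma wsum_Suc: "wsum (Suc n) w v = wsum n w v + int (w (Suc n)) * v (Suc n)"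
  by (simp add: wsum_def)

lemma wsum_Suc_edge_dir:
  assumes "i \<le> n"
  shows "wsum (Suc n) w (edge_dir r S i) = wsum n (step_weights r S n w) (edge_dir r S i)"
  using assms edge_dir_upper[of i "Suc n" S r] edge_dir_lower[of i "Suc n" S r]
  by (simp add: step_weights_def wsum_Suc wsum_lower wsum_upper lessThan_Suc_atMost)

lemma wsum_Suc_edge_dir_self: "wsum (Suc n) w (edge_dir r S (Suc n)) = int (w (Suc n))"
  by (simp add: wsum_def edge_dir_below edge_dir_self)

lemma wsum_Suc_vertex_seq:
  "wsum (Suc n) w (vertex_seq e r S) = wsum n (step_weights r S n w) (vertex_seq e r S) +
     (if Suc n \<in> S then int (w (Suc n)) * ((int e + 1) * int r * (int r + 1) ^ n) else 0)"
  using vertex_seq_upper[of "Suc n" S e r] vertex_seq_lower[of "Suc n" S e r]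
  by (simp add: step_weights_def wsum_Suc wsum_lower wsum_upper lessThan_Suc_atMost algebra_simps)

text \<open>\<open>sigma_K\<close> at \<mu>(S) with the coordinate sum replaced by a weighted sum.
  General weights are needed because eliminating the last coordinate changes them.\<close>

definition vertex_term :: "nat \<Rightarrow> nat \<Rightarrow> nat \<Rightarrow> (nat \<Rightarrow> nat) \<Rightarrow> nat set \<Rightarrow> rat fls" where
  "vertex_term n e r w S = X_pow (wsum n w (vertex_seq e r S)) *
     (\<Prod>i\<in>free_indices n e. 1 / (1 - X_pow ((if i \<in> S then - 1 else 1) * wsum n w (edge_dir r S i))))"

lemma finite_free_indices: "finite (free_indices n e)"
  by (simp add: free_indices_def)

lemma free_indices_Suc: "free_indices (Suc n) e = insert (Suc n) (free_indices n e)"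
  by (auto simp: free_indices_def)

lemma free_indices_0: "free_indices 0 e = (if e = 0 then {} else {0})"
  by (auto simp: free_indices_def)

lemma Suc_notin_free_indices: "Suc n \<notin> free_indices n e"
  by (simp add: free_indices_def)

text \<open>Edge direction n+1 has the single nonzero entry 1 among coordinates 0..n+1, which gives
  the separate factor; vertices and the other edge directions follow the substitution encoded in
  \<open>step_weights\<close>.\<close>

lemma vertex_term_Suc:
  "vertex_term (Suc n) e r w S =
    (if Suc n \<in> S then X_pow (int (w (Suc n)) * ((int e + 1) * int r * (int r + 1) ^ n)) / (1 - X_pow (- int (w (Suc n))))
     else 1 / (1 - X_pow (int (w (Suc n))))) * vertex_term n e r (step_weights r S n w) S"
proof -
  have "(\<Prod>i\<in>free_indices n e. 1 / (1 - X_pow ((if i \<in> S then - 1 else 1) * wsum (Suc n) w (edge_dir r S i)))) =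
    (\<Prod>i\<in>free_indices n e. 1 / (1 - X_pow ((if i \<in> S then - 1 else 1) * wsum n (step_weights r S n w) (edge_dir r S i))))"
    by (intro prod.cong refl) (simp add: wsum_Suc_edge_dir free_indices_def)
  then show ?thesis
    unfolding vertex_term_def free_indices_Suc
    by (subst prod.insert[OF finite_free_indices Suc_notin_free_indices])
       (simp add: wsum_Suc_edge_dir_self wsum_Suc_vertex_seq X_pow_add)
qed

lemma vertex_seq_cong:
  "(\<And>i. i \<le> j \<Longrightarrow> i \<in> S \<longleftrightarrow> i \<in> S') \<Longrightarrow> vertex_seq e r S j = vertex_seq e r S' j"
proof (induction j rule: less_induct)
  case (less j)
  have "vertex_seq e r S k = vertex_seq e r S' k" if "k < j" for k
    using less.prems that by (intro less.IH) auto
  then show ?case using less.prems[of j]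
    by (cases "j = 0"; cases "j \<in> S") (simp_all add: vertex_seq_rec)
qed

lemma edge_dir_cong:
  "(\<And>i. i \<le> j \<Longrightarrow> i \<in> S \<longleftrightarrow> i \<in> S') \<Longrightarrow> edge_dir r S i j = edge_dir r S' i j"
proof (induction j rule: less_induct)
  case (less j)
  have *: "edge_dir r S i k = edge_dir r S' i k" if "k < j" for k
    using less.prems that by (intro less.IH) auto
  consider "j < i" | "j = i" | "i < j" by linarith
  then show ?case using less.prems[of j] *
    by cases (cases "j \<in> S"; simp add: edge_dir_rec)+
qed

lemma vertex_term_cong:
  assumes "S \<inter> {..n} = S' \<inter> {..n}"
  shows "vertex_term n e r w S = vertex_term n e r w S'"
proof -
  have iff: "i \<in> S \<longleftrightarrow> i \<in> S'" if "i \<le> n" for i using assms that by blast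
  have "wsum n w (vertex_seq e r S) = wsum n w (vertex_seq e r S')"
    unfolding wsum_def by (intro sum.cong refl arg_cong2[of _ _ _ _ "(*)"] vertex_seq_cong iff) auto
  moreover have "wsum n w (edge_dir r S i) = wsum n w (edge_dir r S' i)" for i
    unfolding wsum_def by (intro sum.cong refl arg_cong2[of _ _ _ _ "(*)"] edge_dir_cong iff) auto
  ultimately show ?thesis
    unfolding vertex_term_def using iff by (auto simp: free_indices_def intro!: prod.cong)
qed

subsection \<open>Summing over the last coordinate\<close>

lemma lattice_points_iff:
  "\<mu> \<in> lattice_points (polyP n e r) \<longleftrightarrow> 0 \<le> \<mu> 0 \<and> \<mu> 0 \<le> int e \<and>
     (\<forall>i\<in>{1..n}. int r * (\<Sum>j<i. \<mu> j) \<le> \<mu> i \<and>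
        \<mu> i \<le> (int e + 1) * int r * (int r + 1) ^ (i - 1) + \<mu> (i - 1)) \<and>
     (\<forall>i>n. \<mu> i = 0)"
proof -
  have "real r * (\<Sum>j<i. real_of_int (\<mu> j)) \<le> real_of_int (\<mu> i) \<longleftrightarrow> int r * (\<Sum>j<i. \<mu> j) \<le> \<mu> i" for i
    by (metis (no_types) of_int_le_iff of_int_mult of_int_of_nat_eq of_int_sum)
  moreover have "real_of_int (\<mu> i) \<le> (real e + 1) * real r * (real r + 1) ^ (i - 1) + real_of_int (\<mu> (i - 1))
      \<longleftrightarrow> \<mu> i \<le> (int e + 1) * int r * (int r + 1) ^ (i - 1) + \<mu> (i - 1)" for i
  proof -
    have "(real e + 1) * real r * (real r + 1) ^ (i - 1) + real_of_int (\<mu> (i - 1)) =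
      real_of_int ((int e + 1) * int r * (int r + 1) ^ (i - 1) + \<mu> (i - 1))" by simp
    then show ?thesis by (simp only: of_int_le_iff)
  qed
  moreover have "real_of_int (\<mu> 0) \<le> real e \<longleftrightarrow> \<mu> 0 \<le> int e"
    by (metis of_int_le_iff of_int_of_nat_eq)
  ultimately show ?thesis
    unfolding lattice_points_def polyP_def mem_Collect_eq real_vec_def by simp
qed

lemma lattice_points_Suc:
  "\<mu> \<in> lattice_points (polyP (Suc n) e r) \<longleftrightarrow>
     \<mu>(Suc n := 0) \<in> lattice_points (polyP n e r) \<and>
     int r * (\<Sum>j\<le>n. \<mu> j) \<le> \<mu> (Suc n) \<and>
     \<mu> (Suc n) \<le> (int e + 1) * int r * (int r + 1) ^ n + \<mu> n"
proof -
  have sum: "(\<Sum>j<i. (\<mu>(Suc n := 0)) j) = (\<Sum>j<i. \<mu> j)" if "i \<le> n" for i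
    using that by (intro sum.cong) auto
  have "{1..Suc n} = insert (Suc n) {1..n}" by auto
  moreover have "(\<forall>i>n. (\<mu>(Suc n := 0)) i = 0) \<longleftrightarrow> (\<forall>i>Suc n. \<mu> i = 0)"
    by (auto simp: Suc_lessI)
  ultimately show ?thesis
    unfolding lattice_points_iff by (auto simp: sum lessThan_Suc_atMost)
qed

lemma lattice_points_0: "lattice_points (polyP 0 e r) = (\<lambda>k. (\<lambda>_. 0)(0 := k)) ` {0..int e}"
  unfolding set_eq_iff lattice_points_iff by (auto simp: image_iff fun_eq_iff intro!: bexI)

lemma sum_lattice_points_Suc:
  "(\<Sum>\<mu>\<in>lattice_points (polyP (Suc n) e r). f \<mu>) =
   (\<Sum>\<mu>\<in>lattice_points (polyP n e r).
      \<Sum>k\<in>{int r * (\<Sum>j\<le>n. \<mu> j)..(int e + 1) * int r * (int r + 1) ^ n + \<mu> n}. f (\<mu>(Suc n := k)))"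
proof -
  have z: "\<mu> (Suc n) = 0" if "\<mu> \<in> lattice_points (polyP n e r)" for \<mu>
    using that by (simp add: lattice_points_iff)
  then have id: "\<mu>(Suc n := 0) = \<mu>" if "\<mu> \<in> lattice_points (polyP n e r)" for \<mu>
    using that by auto
  show ?thesis
    unfolding sum.Sigma[OF finite_lattice_points ballI[OF finite_atLeastAtMost_int]]
    by (rule sum.reindex_bij_witness[of _ "\<lambda>(\<mu>, k). \<mu>(Suc n := k)" "\<lambda>\<mu>. (\<mu>(Suc n := 0), \<mu> (Suc n))"])
       (auto simp: lattice_points_Suc id z)
qed

text \<open>\<open>slack_gap\<close> at index n+1 uses only the inequalities up to n, so it applies
  to points of \<open>polyP n e r\<close>.\<close>

lemma lattice_points_gap:
  assumes "r \<ge> 1" "\<mu> \<in> lattice_points (polyP n e r)"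
  shows "int r * (\<Sum>j\<le>n. \<mu> j) + 1 \<le> (int e + 1) * int r * (int r + 1) ^ n + \<mu> n"
proof -
  have "real_vec \<mu> \<in> polyP n e r" using assms(2) by (simp add: lattice_points_def)
  then have "1 \<le> slack e r (Suc n) True (real_vec \<mu>) + slack e r (Suc n) (\<not> True) (real_vec \<mu>)"
    by (intro slack_gap assms(1)) (auto simp: polyP_iff_slack)
  then have "1 \<le> real_of_int ((int e + 1) * int r * (int r + 1) ^ n + \<mu> n - int r * (\<Sum>j\<le>n. \<mu> j))"
    by (simp add: slack_def real_vec_def lessThan_Suc_atMost)
  then show ?thesis by linarith
qed

text \<open>Brion's formula for this polytope, by induction on n with varying weights. Positive
  weights keep every ratio of the geometric sums different from 1, and both weight changes preserve
  positivity.\<close>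

lemma brion:
  assumes "r \<ge> 1" "\<And>j. j \<le> n \<Longrightarrow> 0 < w j"
  shows "(\<Sum>\<mu>\<in>lattice_points (polyP n e r). X_pow (wsum n w \<mu>)) =
    (\<Sum>S\<in>Pow (free_indices n e). vertex_term n e r w S)"
  using assms(2)
proof (induction n arbitrary: w)
  case 0
  have "inj_on (\<lambda>k. (\<lambda>_. 0 :: int)(0 :: nat := k)) {0..int e}"
    by (auto simp: inj_on_def dest: fun_cong[of _ _ 0])
  then have "(\<Sum>\<mu>\<in>lattice_points (polyP 0 e r). X_pow (wsum 0 w \<mu>)) = (\<Sum>k\<in>{0..int e}. X_pow (int (w 0) * k))"
    unfolding lattice_points_0 by (subst sum.reindex) (auto simp: wsum_def)
  also have "\<dots> = (\<Sum>S\<in>Pow (free_indices 0 e). vertex_term 0 e r w S)"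
  proof (cases "e = 0")
    case True
    then show ?thesis by (simp add: free_indices_0 vertex_term_def wsum_def vertex_seq_0)
  next
    case False
    then show ?thesis using geometric_interval[of "int (w 0)" 0 "int e"] 0
      by (simp add: free_indices_0 vertex_term_def wsum_def vertex_seq_0 Pow_insert edge_dir_self)
  qed
  finally show ?case .
next
  case (Suc n)
  define W C where "W = int (w (Suc n))" and "C = (int e + 1) * int r * (int r + 1) ^ n"
  have W: "W \<noteq> 0" using Suc.prems[of "Suc n"] by (simp add: W_def)
  have pos: "0 < lower_weights r n w j" "0 < upper_weights n w j" if "j \<le> n" for j
    using Suc.prems[of j] that by (auto simp: lower_weights_def upper_weights_def)
  have "(\<Sum>\<mu>\<in>lattice_points (polyP (Suc n) e r). X_pow (wsum (Suc n) w \<mu>)) =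
    (\<Sum>\<mu>\<in>lattice_points (polyP n e r). \<Sum>k\<in>{int r * (\<Sum>j\<le>n. \<mu> j)..C + \<mu> n}.
       X_pow (wsum n w \<mu>) * X_pow (W * k))"
    unfolding sum_lattice_points_Suc C_def W_def
    by (intro sum.cong refl) (simp add: wsum_def X_pow_add)
  also have "\<dots> = (\<Sum>\<mu>\<in>lattice_points (polyP n e r).
      X_pow (wsum n (lower_weights r n w) \<mu>) * (1 / (1 - X_pow W)) +
      X_pow (wsum n (upper_weights n w) \<mu>) * (X_pow (W * C) / (1 - X_pow (- W))))"
  proof (intro sum.cong refl)
    fix \<mu> assume \<mu>: "\<mu> \<in> lattice_points (polyP n e r)"
    let ?L = "int r * (\<Sum>j\<le>n. \<mu> j)"
    have "(\<Sum>k\<in>{?L..C + \<mu> n}. X_pow (W * k)) = X_pow (W * ?L) / (1 - X_pow W) + X_pow (W * (C + \<mu> n)) / (1 - X_pow (- W))"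
      using lattice_points_gap[OF assms(1) \<mu>] by (intro geometric_interval W) (simp add: C_def)
    then show "(\<Sum>k\<in>{?L..C + \<mu> n}. X_pow (wsum n w \<mu>) * X_pow (W * k)) =
      X_pow (wsum n (lower_weights r n w) \<mu>) * (1 / (1 - X_pow W)) +
      X_pow (wsum n (upper_weights n w) \<mu>) * (X_pow (W * C) / (1 - X_pow (- W)))"
      unfolding sum_distrib_left[symmetric] wsum_lower wsum_upper W_def[symmetric]
      by (simp add: X_pow_add algebra_simps)
  qed
  also have "\<dots> = (\<Sum>S\<in>Pow (free_indices n e). vertex_term n e r (lower_weights r n w) S * (1 / (1 - X_pow W))) +
      (\<Sum>S\<in>Pow (free_indices n e). vertex_term n e r (upper_weights n w) S * (X_pow (W * C) / (1 - X_pow (- W))))"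
    unfolding sum.distrib sum_distrib_right[symmetric] using Suc.IH pos by simp
  also have "(\<Sum>S\<in>Pow (free_indices n e). vertex_term n e r (lower_weights r n w) S * (1 / (1 - X_pow W))) =
      (\<Sum>S\<in>Pow (free_indices n e). vertex_term (Suc n) e r w S)"
    using Suc_notin_free_indices
    by (intro sum.cong refl) (auto simp: vertex_term_Suc step_weights_def W_def)
  \<comment> \<open>Lower ends have produced the vertices with n+1 not in S; upper ends produce
    those with n+1 in S.\<close>
  also have "(\<Sum>S\<in>Pow (free_indices n e). vertex_term n e r (upper_weights n w) S * (X_pow (W * C) / (1 - X_pow (- W)))) =
      (\<Sum>S\<in>insert (Suc n) ` Pow (free_indices n e). vertex_term (Suc n) e r w S)"
  proof -
    have "vertex_term n e r v (insert (Suc n) S) = vertex_term n e r v S" for v S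
      by (rule vertex_term_cong) auto
    moreover have "inj_on (insert (Suc n)) (Pow (free_indices n e))"
      using Suc_notin_free_indices[of n e] by (intro inj_onI) (metis PowD insert_ident subsetD)
    ultimately show ?thesis
      by (subst sum.reindex) (auto simp: vertex_term_Suc step_weights_def W_def C_def intro!: sum.cong)
  qed
  also have "(\<Sum>S\<in>Pow (free_indices n e). vertex_term (Suc n) e r w S) +
       (\<Sum>S\<in>insert (Suc n) ` Pow (free_indices n e). vertex_term (Suc n) e r w S) =
     (\<Sum>S\<in>Pow (free_indices (Suc n) e). vertex_term (Suc n) e r w S)"
    unfolding free_indices_Suc Pow_insert using Suc_notin_free_indices finite_free_indices
    by (intro sum.union_disjoint[symmetric]) auto
  finally show ?case .
qed

lemma sigma_P_eq:
  assumes "r \<ge> 1"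
  shows "sigma_P n e r = (\<Sum>S\<in>Pow (free_indices n e). vertex_term n e r (\<lambda>_. 1) S)"
  using brion[OF assms, of n "\<lambda>_. 1" e]
  by (simp add: sigma_P_def X_pow_def wsum_def coord_sum_def)

lemma sigma_K_eq:
  assumes "r \<ge> 1" "S \<subseteq> free_indices n e"
  shows "sigma_K n e r (vertex n e r S) = vertex_term n e r (\<lambda>_. 1) S"
proof -
  have inj: "inj_on (\<lambda>i. vertex n e r (sym_diff S {i})) (free_indices n e)"
  proof (rule inj_onI)
    fix i j assume ij: "i \<in> free_indices n e" "j \<in> free_indices n e"
      and eq: "vertex n e r (sym_diff S {i}) = vertex n e r (sym_diff S {j})"
    have "sym_diff S {i} = sym_diff S {j}"
      using eq ij assms(2) by (subst (asm) vertex_eq_iff[OF assms(1)]) auto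
    then show "i = j" by blast
  qed
  have "coord_sum n (vertex n e r S) = wsum n (\<lambda>_. 1) (vertex_seq e r S)"
    by (simp add: coord_sum_def wsum_def vertex_def)
  then show ?thesis
    unfolding sigma_K_def vertex_term_def neighbours_eq[OF assms] X_pow_def[symmetric]
    by (subst prod.reindex[OF inj])
      (auto simp: coord_sum_primitive_dir[OF assms(1)] wsum_def intro!: prod.cong)
qed

subsection \<open>The order of the contribution of a vertex\<close>

text \<open>
  The summand \<open>+ 1\<close> (and the \<open>1\<close> in \<open>e + 1\<close>) is the order \<open>d\<close> of \<open>1 / (1 - x\<^bsup>-d\<^esup>)\<close>.
\<close>

fun term_order :: "nat \<Rightarrow> nat \<Rightarrow> nat set \<Rightarrow> nat \<Rightarrow> (nat \<Rightarrow> nat) \<Rightarrow> nat" where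
  "term_order e r S 0 w = (if 0 \<in> S then w 0 * (e + 1) else 0)"
| "term_order e r S (Suc n) w =
     (if Suc n \<in> S then w (Suc n) * ((e + 1) * r * (r + 1) ^ n + 1) else 0) +
     term_order e r S n (step_weights r S n w)"

lemma step_weights_ge: "j \<le> n \<Longrightarrow> w j \<le> step_weights r S n w j"
  by (simp add: step_weights_def upper_weights_def lower_weights_def)

text \<open>For e = 0 there is no factor for index 0, while \<open>term_order\<close> counts one
  when 0 is in S; this case is excluded by the second assumption.\<close>

lemma ord_ge_vertex_term:
  assumes "\<And>j. j \<le> n \<Longrightarrow> 0 < w j" "0 \<in> S \<Longrightarrow> 0 < e"
  shows "ord_ge (term_order e r S n w) (vertex_term n e r w S)"
  using assms(1)
proof (induction n arbitrary: w)
  case 0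
  show ?case
  proof (cases "0 \<in> S")
    case True
    have "ord_ge (w 0 * e + w 0) (X_pow (int (w 0 * e)) * (1 / (1 - X_pow (- int (w 0)))))"
      using 0 by (intro ord_ge_mult ord_ge_X_pow ord_ge_geometric_neg) auto
    then show ?thesis using True assms(2)
      by (simp add: vertex_term_def wsum_def vertex_seq_0 free_indices_0 edge_dir_self algebra_simps)
  next
    case False
    have "ord_ge 0 1" using ord_ge_X_pow[of 0] by simp
    moreover have "ord_ge 0 (1 / (1 - X_pow (int (w 0))))"
      using 0 by (intro ord_ge_geometric) auto
    ultimately show ?thesis using False
      by (auto simp: vertex_term_def wsum_def vertex_seq_0 free_indices_0 edge_dir_self)
  qed
next
  case (Suc n)
  have IH: "ord_ge (term_order e r S n (step_weights r S n w)) (vertex_term n e r (step_weights r S n w) S)"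
    using Suc.prems step_weights_ge[of _ n w r S] by (intro Suc.IH) (metis le_SucI order_less_le_trans)
  have w: "0 < w (Suc n)" using Suc.prems by simp
  show ?case
  proof (cases "Suc n \<in> S")
    case True
    have "ord_ge (w (Suc n) * ((e + 1) * r * (r + 1) ^ n) + w (Suc n) + term_order e r S n (step_weights r S n w))
      (X_pow (int (w (Suc n) * ((e + 1) * r * (r + 1) ^ n))) * (1 / (1 - X_pow (- int (w (Suc n))))) *
        vertex_term n e r (step_weights r S n w) S)"
      using w by (intro ord_ge_mult ord_ge_X_pow ord_ge_geometric_neg IH)
    then show ?thesis using True by (simp add: vertex_term_Suc algebra_simps)
  next
    case False
    have "ord_ge (0 + term_order e r S n (step_weights r S n w))
      (1 / (1 - X_pow (int (w (Suc n)))) * vertex_term n e r (step_weights r S n w) S)"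
      using w by (intro ord_ge_mult ord_ge_geometric IH)
    then show ?thesis using False by (simp add: vertex_term_Suc)
  qed
qed

section \<open>Lower bounds for the order\<close>

lemma step_weights_lower: "Suc n \<notin> S \<Longrightarrow> step_weights r S n w = (\<lambda>j. w j + r * w (Suc n))"
  and step_weights_upper: "Suc n \<in> S \<Longrightarrow> step_weights r S n w = w(n := w n + w (Suc n))"
  by (simp_all add: step_weights_def upper_weights_def lower_weights_def)

lemma step_weights_lower_ge:
  assumes "\<And>j. j \<le> Suc n \<Longrightarrow> V \<le> w j" "Suc n \<notin> S" "j \<le> n"
  shows "(r + 1) * V \<le> step_weights r S n w j"
proof -
  have "V + r * V \<le> w j + r * w (Suc n)" using assms by (intro add_mono mult_left_mono) auto
  then show ?thesis using assms(2) by (simp add: step_weights_lower)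
qed

lemma le_step_weights:
  assumes "\<And>j. j \<le> Suc n \<Longrightarrow> V \<le> w j" "j \<le> n"
  shows "V \<le> step_weights r S n w j"
  using step_weights_ge[OF assms(2), of w r S] assms(1)[of j] assms(2) by simp

text \<open>The factor guaranteed by one element of S; the extremal position is n, where the weights
  have not yet been multiplied by a lower step.\<close>

definition least_gap :: "nat \<Rightarrow> nat \<Rightarrow> nat" where
  "least_gap r n = (if n = 0 then 1 else r * (r + 1) ^ (n - 1))"

lemma term_order_nonempty:
  assumes "\<And>j. j \<le> n \<Longrightarrow> V \<le> w j" "S \<inter> {..n} \<noteq> {}"
  shows "V * (e + 1) * least_gap r n \<le> term_order e r S n w"
  using assms
proof (induction n arbitrary: V w)
  case 0
  then show ?case using mult_right_mono[of V "w 0" "e + 1"] by (auto simp: least_gap_def)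
next
  case (Suc n)
  show ?case
  proof (cases "Suc n \<in> S")
    case True
    have "V * ((e + 1) * r * (r + 1) ^ n) \<le> w (Suc n) * ((e + 1) * r * (r + 1) ^ n + 1)"
      using Suc.prems(1)[of "Suc n"] by (intro mult_mono) auto
    then show ?thesis using True by (simp add: least_gap_def algebra_simps)
  next
    case False
    then have ne: "S \<inter> {..n} \<noteq> {}" using Suc.prems(2) by (auto simp: atMost_Suc)
    have "(r + 1) * V * (e + 1) * least_gap r n \<le> term_order e r S n (step_weights r S n w)"
      using step_weights_lower_ge[OF Suc.prems(1) False] ne by (intro Suc.IH) auto
    moreover have "least_gap r (Suc n) \<le> (r + 1) * least_gap r n"
      by (cases n) (auto simp: least_gap_def algebra_simps)
    then have "V * (e + 1) * least_gap r (Suc n) \<le> V * (e + 1) * ((r + 1) * least_gap r n)"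
      by (rule mult_left_mono) simp
    ultimately show ?thesis using False by (simp add: algebra_simps)
  qed
qed

text \<open>Every step gains a factor r + 1: a lower step multiplies the weights by it, and an upper
  step adds r(r+1)^n to the (r+1)^n obtained from below.\<close>

lemma term_order_zero_mem:
  assumes "\<And>j. j \<le> n \<Longrightarrow> V \<le> w j" "0 \<in> S"
  shows "V * (e + 1) * (r + 1) ^ n \<le> term_order e r S n w"
  using assms(1)
proof (induction n arbitrary: V w)
  case 0
  then show ?case using mult_right_mono[of V "w 0" "e + 1"] assms(2) by auto
next
  case (Suc n)
  show ?case
  proof (cases "Suc n \<in> S")
    case True
    have "V * ((e + 1) * r * (r + 1) ^ n) \<le> w (Suc n) * ((e + 1) * r * (r + 1) ^ n + 1)"
      using Suc.prems(1)[of "Suc n"] by (intro mult_mono) auto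
    moreover have "V * (e + 1) * (r + 1) ^ n \<le> term_order e r S n (step_weights r S n w)"
      using le_step_weights[OF Suc.prems] by (intro Suc.IH)
    ultimately show ?thesis using True by (simp add: algebra_simps)
  next
    case False
    have "(r + 1) * V * (e + 1) * (r + 1) ^ n \<le> term_order e r S n (step_weights r S n w)"
      using step_weights_lower_ge[OF Suc.prems False] by (intro Suc.IH)
    then show ?thesis using False by (simp add: algebra_simps)
  qed
qed

text \<open>For r = 1 two elements give three quarters of the full order V(e+1)2^(n+1): a top
  element gives one half and any further element below it a quarter. Both sides are scaled to avoid
  fractions.\<close>

lemma term_order_two_mem:
  assumes "\<And>j. j \<le> Suc n \<Longrightarrow> V \<le> w j" "2 \<le> card (S \<inter> {..Suc n})"
  shows "3 * (V * (e + 1) * 2 ^ n) \<le> 2 * term_order e 1 S (Suc n) w"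
  using assms
proof (induction n arbitrary: V w)
  case 0
  have "S \<inter> {..Suc 0} = {0, 1}"
    by (rule card_seteq) (use 0(2) in \<open>auto simp: le_Suc_eq\<close>)
  then have "0 \<in> S" "Suc 0 \<in> S" by auto
  have "V * (e + 1) \<le> term_order e 1 S 0 (step_weights 1 S 0 w)"
    using term_order_zero_mem[of 0 V _ S e 1] le_step_weights[OF 0(1)] \<open>0 \<in> S\<close> by fastforce
  moreover have "V * (e + 1) \<le> w (Suc 0) * (e + 2)"
    using 0(1)[of "Suc 0"] by (intro mult_mono) auto
  ultimately show ?case using \<open>Suc 0 \<in> S\<close> by simp
next
  case (Suc n)
  show ?case
  proof (cases "Suc (Suc n) \<in> S")
    case True
    have "\<not> S \<inter> {..Suc (Suc n)} \<subseteq> {Suc (Suc n)}"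
      using Suc.prems(2) card_mono[of "{Suc (Suc n)}" "S \<inter> {..Suc (Suc n)}"] by auto
    then have "S \<inter> {..Suc n} \<noteq> {}" by (auto simp: atMost_Suc)
    then have "V * (e + 1) * least_gap 1 (Suc n) \<le> term_order e 1 S (Suc n) (step_weights 1 S (Suc n) w)"
      using le_step_weights[OF Suc.prems(1)] by (intro term_order_nonempty)
    moreover have "least_gap 1 (Suc n) = 2 ^ n" by (simp add: least_gap_def numeral_2_eq_2)
    moreover have "V * ((e + 1) * 2 ^ Suc n) \<le> w (Suc (Suc n)) * ((e + 1) * 2 ^ Suc n + 1)"
      using Suc.prems(1)[of "Suc (Suc n)"] by (intro mult_mono) auto
    ultimately show ?thesis using True
      by (subst term_order.simps(2)) (simp add: algebra_simps numeral_2_eq_2[symmetric] del: term_order.simps)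
  next
    case False
    then have "S \<inter> {..Suc (Suc n)} = S \<inter> {..Suc n}" by (auto simp: atMost_Suc)
    then have "3 * (2 * V * (e + 1) * 2 ^ n) \<le> 2 * term_order e 1 S (Suc n) (step_weights 1 S (Suc n) w)"
      using step_weights_lower_ge[OF Suc.prems(1) False, where r=1] Suc.prems(2)
      by (intro Suc.IH) (auto simp: numeral_2_eq_2)
    then show ?thesis using False
      by (subst term_order.simps(2)) (simp add: algebra_simps del: term_order.simps)
  qed
qed

definition leading_sets :: "nat \<Rightarrow> nat \<Rightarrow> nat set set" where
  "leading_sets r n = {{}} \<union> (\<lambda>j. {j}) ` {1..n} \<union>
     (if r = 1 then (\<lambda>(j1, j2). {j1, j2}) ` (SIGMA j1:{1..n}. {j1 + 2..n}) else {})"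

lemma term_order_ge:
  assumes r: "r \<ge> 1" and "\<And>j. j \<le> n \<Longrightarrow> W \<le> w j" "S \<subseteq> {..n}" "S \<notin> leading_sets r n"
  shows "W * (e + 1) * (r + 1) ^ n \<le> term_order e r S n w"
  using assms(2-)
proof (induction n arbitrary: W w)
  case 0
  then have "0 \<in> S" by (auto simp: leading_sets_def)
  then show ?case using term_order_zero_mem[of 0 W w S e r] 0(1) by simp
next
  case (Suc n)
  show ?case
  proof (cases "0 \<in> S")
    case True
    then show ?thesis using term_order_zero_mem[of "Suc n" W w S e r] Suc.prems(1) by blast
  next
    case S0: False
    show ?thesis
    proof (cases "Suc n \<in> S")
      case False
      have "leading_sets r n \<subseteq> leading_sets r (Suc n)"
        by (force simp: leading_sets_def)
      moreover have "S \<subseteq> {..n}" using False Suc.prems(2) by (auto simp: atMost_Suc)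
      ultimately have "(r + 1) * W * (e + 1) * (r + 1) ^ n \<le> term_order e r S n (step_weights r S n w)"
        using step_weights_lower_ge[OF Suc.prems(1) False] Suc.prems(3) by (intro Suc.IH) auto
      then show ?thesis using False by (simp add: algebra_simps)
    next
      case True
      have top: "W * ((e + 1) * r * (r + 1) ^ n) \<le> w (Suc n) * ((e + 1) * r * (r + 1) ^ n + 1)"
        using Suc.prems(1)[of "Suc n"] by (intro mult_mono) auto
      have "S \<noteq> {Suc n}" using Suc.prems(3) by (auto simp: leading_sets_def)
      then obtain i where i: "i \<in> S" "i \<noteq> Suc n" using True by blast
      have "i \<le> n" "i \<noteq> 0"
        using i Suc.prems(2) S0 by (metis atMost_iff le_SucE subsetD) (use i S0 in metis)
      then have "n \<noteq> 0" by simp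
      then obtain p where p: "n = Suc p" by (cases n) auto
      \<comment> \<open>The top element already supplies r(r+1)^n of the required (r+1)^(n+1); the
        elements below must supply the rest.\<close>
      have ge: "W * (e + 1) * (r + 1) ^ n \<le> term_order e r S n (step_weights r S n w)"
      proof (cases "n \<in> S")
        case nS: True
        \<comment> \<open>The upper step at n+1 moves its weight onto coordinate n, so an adjacent
          element counts twice, and 2r \<ge> r + 1.\<close>
        have "2 * W \<le> step_weights r S n w n"
          using True Suc.prems(1)[of n] Suc.prems(1)[of "Suc n"] by (simp add: step_weights_upper)
        then have "2 * W * ((e + 1) * r * (r + 1) ^ p) \<le>
            step_weights r S n w n * ((e + 1) * r * (r + 1) ^ p + 1)"
          by (intro mult_mono) auto
        also have "\<dots> \<le> term_order e r S n (step_weights r S n w)" using nS p by simp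
        finally have "2 * W * ((e + 1) * r * (r + 1) ^ p) \<le> term_order e r S n (step_weights r S n w)" .
        moreover have "(r + 1) * (W * (e + 1) * (r + 1) ^ p) \<le> (2 * r) * (W * (e + 1) * (r + 1) ^ p)"
          using r by (intro mult_right_mono) auto
        ultimately show ?thesis by (simp add: p algebra_simps del: term_order.simps)
      next
        case nS: False
        define v where "v = step_weights r S p (step_weights r S n w)"
        \<comment> \<open>The lower step at n spreads r times the doubled weight over all earlier
          coordinates.\<close>
        have v: "(2 * r + 1) * W \<le> v j" if "j \<le> p" for j
        proof -
          have "r * (2 * W) \<le> r * (w n + w (Suc n))"
            using Suc.prems(1)[of n] Suc.prems(1)[of "Suc n"] by (intro mult_left_mono) auto
          moreover have "W \<le> w j" using Suc.prems(1) that p by simp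
          ultimately show ?thesis using True nS that p
            by (simp add: v_def step_weights_lower step_weights_upper algebra_simps)
        qed
        have lv: "term_order e r S n (step_weights r S n w) = term_order e r S p v"
          using nS by (simp add: p v_def)
        have ip: "i \<le> p" using i nS Suc.prems(2) p by (metis atMost_iff le_SucE subsetD)
        then have "p \<noteq> 0" using \<open>i \<noteq> 0\<close> by simp
        then obtain q where q: "p = Suc q" by (cases p) auto
        show ?thesis
        proof (cases "r = 1")
          case False
          have "S \<inter> {..p} \<noteq> {}" using i ip by blast
          then have "(2 * r + 1) * W * (e + 1) * least_gap r p \<le> term_order e r S p v"
            using v by (intro term_order_nonempty)
          moreover have gap: "least_gap r p = r * (r + 1) ^ q" by (simp add: q least_gap_def)
          \<comment> \<open>This fails for r = 1 (4 against 3), which is where the nonadjacent pairs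
            in the theorem come from.\<close>
          have "(r + 1) * (r + 1) \<le> (2 * r + 1) * r"
          proof -
            have "2 \<le> r" using False r by simp
            then obtain t where "r = 2 + t" using le_Suc_ex by blast
            then show ?thesis by (simp add: algebra_simps)
          qed
          then have "(r + 1) * (r + 1) * (W * (e + 1) * (r + 1) ^ q) \<le>
              (2 * r + 1) * r * (W * (e + 1) * (r + 1) ^ q)"
            by (rule mult_right_mono) simp
          moreover have "(2 * r + 1) * W * (e + 1) * least_gap r p =
              (2 * r + 1) * r * (W * (e + 1) * (r + 1) ^ q)"
            by (simp only: gap mult_ac)
          moreover have "W * (e + 1) * (r + 1) ^ n = (r + 1) * (r + 1) * (W * (e + 1) * (r + 1) ^ q)"
            by (simp only: p q power_Suc mult_ac)
          ultimately show ?thesis unfolding lv by linarith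
        next
          case r1: True
          have sub: "S \<subseteq> insert (Suc n) {..p}"
          proof
            fix j assume "j \<in> S"
            then have "j \<le> Suc n" "j \<noteq> n" using Suc.prems(2) nS by auto
            then show "j \<in> insert (Suc n) {..p}" using p by auto
          qed
          have "S \<inter> {..p} \<noteq> {i}"
          proof
            assume "S \<inter> {..p} = {i}"
            then have "S = {i, Suc n}" using sub True by blast
            moreover have "i \<in> {1..Suc n}" "Suc n \<in> {i + 2..Suc n}"
              using ip p i S0 by (auto intro: gr0I simp: Suc_le_eq)
            ultimately have "S \<in> leading_sets r (Suc n)"
              unfolding leading_sets_def using r1 by (auto intro!: image_eqI[of _ _ "(i, Suc n)"])
            then show False using Suc.prems(3) by blast
          qed
          then obtain j where "j \<in> S" "j \<le> p" "j \<noteq> i" using i ip by blast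
          then have "card {i, j} \<le> card (S \<inter> {..p})" using i ip by (intro card_mono) auto
          \<comment> \<open>With S not a nonadjacent pair there are two elements up to p, and the
            tripled weight gives 9/2 where 4 is needed.\<close>
          then have "3 * (3 * W * (e + 1) * 2 ^ q) \<le> 2 * term_order e 1 S p v"
            using v r1 \<open>j \<noteq> i\<close> unfolding q by (intro term_order_two_mem) auto
          moreover have "3 * (3 * W * (e + 1) * 2 ^ q) = 9 * (W * (e + 1) * 2 ^ q)"
            by (simp add: algebra_simps)
          moreover have "(r + 1) ^ n = 4 * 2 ^ q"
            by (simp add: p q r1 flip: numeral_2_eq_2)
          then have "W * (e + 1) * (r + 1) ^ n = 4 * (W * (e + 1) * 2 ^ q)"
            by (simp add: algebra_simps)
          ultimately show ?thesis using lv unfolding r1 by linarith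
        qed
      qed
      from True top ge show ?thesis by (simp add: algebra_simps)
    qed
  qed
qed

section \<open>The expansion of the generating function\<close>

lemma leading_sets_subset: "leading_sets r n \<subseteq> Pow (free_indices n e)"
  by (auto simp: leading_sets_def free_indices_def split: if_splits)

lemma sum_leading_sets:
  fixes f :: "nat set \<Rightarrow> rat fls"
  shows "(\<Sum>S\<in>leading_sets r n. f S) = f {} + (\<Sum>j = 1..n. f {j}) +
     chi r * (\<Sum>j1 = 1..n. \<Sum>j2 = j1 + 2..n. f {j1, j2})"
proof -
  define P where "P = (SIGMA j1:{1..n}. {j1 + 2..n})"
  have fin: "finite P" by (simp add: P_def)
  have inj: "inj_on (\<lambda>(j1, j2). {j1, j2}) P"
    by (auto simp: inj_on_def P_def doubleton_eq_iff)
  have two: "(\<Sum>S\<in>(\<lambda>(j1, j2). {j1, j2}) ` P. f S) = (\<Sum>j1 = 1..n. \<Sum>j2 = j1 + 2..n. f {j1, j2})"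
    by (subst sum.reindex[OF inj]) (simp add: P_def sum.Sigma case_prod_unfold)
  have one: "(\<Sum>S\<in>{{}} \<union> (\<lambda>j. {j}) ` {1..n}. f S) = f {} + (\<Sum>j = 1..n. f {j})"
    by (subst sum.union_disjoint) (auto simp: sum.reindex)
  show ?thesis
  proof (cases "r = 1")
    case True
    have "leading_sets r n = ({{}} \<union> (\<lambda>j. {j}) ` {1..n}) \<union> (\<lambda>(j1, j2). {j1, j2}) ` P"
      using True by (simp add: leading_sets_def P_def)
    moreover have "({{}} \<union> (\<lambda>j. {j}) ` {1..n}) \<inter> (\<lambda>(j1, j2). {j1, j2}) ` P = {}"
    proof -
      have "card S \<le> 1" if "S \<in> {{}} \<union> (\<lambda>j. {j}) ` {1..n}" for S using that by auto
      moreover have "card S = 2" if "S \<in> (\<lambda>(j1, j2). {j1, j2}) ` P" for S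
        using that by (auto simp: P_def card_insert_if)
      ultimately show ?thesis by (metis disjoint_iff one_less_numeral_iff linorder_not_less semiring_norm(76))
    qed
    ultimately have "(\<Sum>S\<in>leading_sets r n. f S) =
      (\<Sum>S\<in>{{}} \<union> (\<lambda>j. {j}) ` {1..n}. f S) + (\<Sum>S\<in>(\<lambda>(j1, j2). {j1, j2}) ` P. f S)"
      using fin by (simp only: sum.union_disjoint finite_imageI finite_UnI finite.intros finite_atLeastAtMost)
    then show ?thesis using True by (simp only: one two chi_def if_True mult_1 simp_thms)
  next
    case False
    then show ?thesis by (simp only: leading_sets_def if_False Un_empty_right one chi_def mult_zero_left add_0_right)
  qed
qed

lemma sigma_P_expansion:
  assumes r: "r \<ge> 1"
  obtains R :: "rat fps" where "\<And>k. k < (e + 1) * (r + 1) ^ n \<Longrightarrow> fps_nth R k = 0"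
    "sigma_P n e r =
             sigma_K n e r (vertex n e r {})
             + (\<Sum>j = 1..n. sigma_K n e r (vertex n e r {j}))
             + chi r * (\<Sum>j1 = 1..n. \<Sum>j2 = j1 + 2..n. sigma_K n e r (vertex n e r {j1, j2}))
             + fps_to_fls R"
proof -
  let ?T = "vertex_term n e r (\<lambda>_. 1)"
  let ?A = "Pow (free_indices n e)"
  have "ord_ge ((e + 1) * (r + 1) ^ n) (\<Sum>S\<in>?A - leading_sets r n. ?T S)"
  proof (rule ord_ge_sum)
    fix S assume S: "S \<in> ?A - leading_sets r n"
    then have "S \<subseteq> {..n}" "0 \<in> S \<Longrightarrow> 0 < e" by (auto simp: free_indices_def)
    then have "ord_ge (term_order e r S n (\<lambda>_. 1)) (?T S)" by (intro ord_ge_vertex_term) auto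
    moreover have "(e + 1) * (r + 1) ^ n \<le> term_order e r S n (\<lambda>_. 1)"
      using S \<open>S \<subseteq> {..n}\<close> term_order_ge[OF r, of n 1 "\<lambda>_. 1" S e] by auto
    ultimately show "ord_ge ((e + 1) * (r + 1) ^ n) (?T S)" by (rule ord_ge_mono)
  qed
  then obtain R where R: "(\<Sum>S\<in>?A - leading_sets r n. ?T S) = fps_to_fls R"
    "\<And>k. k < (e + 1) * (r + 1) ^ n \<Longrightarrow> fps_nth R k = 0"
    by (rule ord_ge_imp_fps) blast
  have "sigma_P n e r = (\<Sum>S\<in>leading_sets r n. ?T S) + fps_to_fls R"
    unfolding sigma_P_eq[OF r] R(1)[symmetric]
    by (subst sum.subset_diff[OF leading_sets_subset[of r n e]]) (simp_all add: finite_free_indices)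
  also have "(\<Sum>S\<in>leading_sets r n. ?T S) = (\<Sum>S\<in>leading_sets r n. sigma_K n e r (vertex n e r S))"
    using leading_sets_subset[of r n e] by (intro sum.cong refl sigma_K_eq[symmetric] r) auto
  finally show ?thesis using that R(2) unfolding sum_leading_sets by blast
qed

subsection \<open>Bounds on the parts of \<open>(e,r)\<close>-partitions\<close>

text \<open>The bound on the sum of k parts; the division is exact by
  \<open>mult_geometric_sum_nat\<close>.\<close>

definition max_sum :: "nat \<Rightarrow> nat \<Rightarrow> nat \<Rightarrow> nat" where
  "max_sum e r k = (e + 1) * (((r + 1) ^ k - 1) div r)"

lemma mult_geometric_sum_nat: "r * (\<Sum>j<k. (r + 1) ^ j) + 1 = (r + 1) ^ k" for r :: nat
  by (induction k) (auto simp: algebra_simps)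

lemma max_sum_eq_sum:
  assumes "r \<ge> 1" shows "max_sum e r k = (\<Sum>j<k. (e + 1) * (r + 1) ^ j)"
proof -
  have "(r + 1) ^ k - 1 = r * (\<Sum>j<k. (r + 1) ^ j)"
    using mult_geometric_sum_nat[of r k] by simp
  then show ?thesis unfolding max_sum_def sum_distrib_left[symmetric] using assms by simp
qed

lemma mult_max_sum:
  assumes "r \<ge> 1" shows "r * max_sum e r k + (e + 1) = (e + 1) * (r + 1) ^ k"
proof -
  have "r * max_sum e r k = (e + 1) * (r * (\<Sum>j<k. (r + 1) ^ j))"
    unfolding max_sum_eq_sum[OF assms] sum_distrib_left[symmetric] by (simp only: mult_ac)
  then show ?thesis
    unfolding mult_geometric_sum_nat[of r k, symmetric] by (simp only: distrib_left mult_1_right)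
qed

lemma max_sum_0 [simp]: "max_sum e r 0 = 0"
  by (simp add: max_sum_def)

lemma max_sum_Suc: "r \<ge> 1 \<Longrightarrow> max_sum e r (Suc k) = e + 1 + (r + 1) * max_sum e r k"
  using mult_max_sum[of r e k] by (simp add: max_sum_eq_sum)

lemma max_sum_mono: "r \<ge> 1 \<Longrightarrow> k \<le> l \<Longrightarrow> max_sum e r k \<le> max_sum e r l"
  by (simp add: max_sum_eq_sum sum_mono2)

lemma le_max_sum: "r \<ge> 1 \<Longrightarrow> k \<le> max_sum e r k"
  by (induction k) (auto simp: max_sum_Suc)

definition parts_bounded :: "nat \<Rightarrow> nat \<Rightarrow> nat list \<Rightarrow> bool" where
  "parts_bounded e r l \<longleftrightarrow> (\<forall>i<length l. l ! i \<le> e + 1 + r * (\<Sum>j<i. l ! j))"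

lemma sum_list_eq_sum: "sum_list l = (\<Sum>j<length l. l ! j)" for l :: "nat list"
  by (simp add: sum_list_sum_nth atLeast0LessThan)

text \<open>Greedy choice: take the last part x as often as allowed. If the remainder exceeds what
  the earlier parts can reach, then fewer than r copies were taken, so it is below x \<le> e + 1 +
  rs, and using all earlier parts r times misses it by at most e.\<close>

lemma representable_below:
  assumes "parts_bounded e r l" "\<forall>a\<in>set l. 0 < a" "k \<le> length l" "b \<le> r * (\<Sum>j<k. l ! j)"
  shows "\<exists>\<alpha>. (\<forall>j<k. \<alpha> j \<le> r) \<and> (\<Sum>j<k. \<alpha> j * l ! j) \<le> b \<and> b \<le> (\<Sum>j<k. \<alpha> j * l ! j) + e"
  using assms(3,4)
proof (induction k arbitrary: b)
  case 0
  then show ?case by simp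
next
  case (Suc k)
  define s x c where "s = (\<Sum>j<k. l ! j)" and "x = l ! k" and "c = min r (b div x)"
  have x: "0 < x" "x \<le> e + 1 + r * s"
    using Suc.prems assms(1,2) by (auto simp: x_def s_def parts_bounded_def)
  have "c * x \<le> (b div x) * x" unfolding c_def by (rule mult_le_mono1) simp
  then have cx: "c * x \<le> b" by (rule order.trans) (rule div_times_less_eq_dividend)
  have b: "b \<le> r * s + r * x"
    using Suc.prems by (simp add: s_def x_def distrib_left)
  have ext: "(\<Sum>j<Suc k. (\<alpha>(k := c)) j * l ! j) = (\<Sum>j<k. \<alpha> j * l ! j) + c * x" for \<alpha>
    by (simp add: x_def)
  have "\<exists>\<alpha>. (\<forall>j<k. \<alpha> j \<le> r) \<and> (\<Sum>j<k. \<alpha> j * l ! j) \<le> b - c * x \<and>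
      b - c * x \<le> (\<Sum>j<k. \<alpha> j * l ! j) + e"
  proof (cases "b - c * x \<le> r * s")
    case True
    then show ?thesis using Suc by (simp add: s_def)
  next
    case False
    then have "c \<noteq> r" using b by auto
    then have "b - c * x = b mod x" by (simp add: c_def min_def minus_div_mult_eq_mod split: if_splits)
    then have "b - c * x < x" using x(1) by simp
    then have "(\<Sum>j<k. r * l ! j) \<le> b - c * x \<and> b - c * x \<le> (\<Sum>j<k. r * l ! j) + e"
      using False x(2) by (simp add: s_def sum_distrib_left)
    then show ?thesis by (intro exI[of _ "\<lambda>_. r"]) auto
  qed
  then obtain \<alpha> where \<alpha>: "\<forall>j<k. \<alpha> j \<le> r" "(\<Sum>j<k. \<alpha> j * l ! j) \<le> b - c * x"
      "b - c * x \<le> (\<Sum>j<k. \<alpha> j * l ! j) + e" by blast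
  have "c \<le> r" by (simp add: c_def)
  then have "\<forall>j<Suc k. (\<alpha>(k := c)) j \<le> r" using \<alpha>(1) by (simp add: less_Suc_eq)
  then show ?case using \<alpha>(2,3) cx by (intro exI[of _ "\<alpha>(k := c)"]) (auto simp only: ext)
qed

lemma er_partition_iff:
  assumes "r \<ge> 1"
  shows "er_partition e r m l \<longleftrightarrow> is_partition m l \<and> parts_bounded e r l"
proof (intro iffI conjI)
  assume er: "er_partition e r m l"
  then show part: "is_partition m l" by (simp add: er_partition_def)
  show "parts_bounded e r l"
    unfolding parts_bounded_def
  proof (intro allI impI, rule ccontr)
    fix i assume i: "i < length l" and "\<not> l ! i \<le> e + 1 + r * (\<Sum>j<i. l ! j)"
    \<comment> \<open>The window R+1..R+1+e is missed: a sum using a part of index at least i is at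
      least \<open>l ! i\<close> by sortedness, and all other sums are at most R.\<close>
    define R where "R = r * (\<Sum>j<i. l ! j)"
    have big: "R + 1 + e < l ! i" using \<open>\<not> _\<close> by (simp add: R_def)
    have "l ! i \<le> m" using part i by (auto simp: is_partition_def intro: member_le_sum_list)
    also have "m \<le> r * m" using assms by simp
    finally have "R + 1 + e \<le> r * m" using big by simp
    moreover have "t \<notin> represented r l" if t: "t \<in> {R + 1..R + 1 + e}" for t
    proof
      assume "t \<in> represented r l"
      then obtain \<alpha> where \<alpha>: "t = (\<Sum>j<length l. \<alpha> j * l ! j)" "\<forall>j<length l. \<alpha> j \<le> r"
        by (auto simp: represented_def)
      show False
      proof (cases "\<exists>j<length l. i \<le> j \<and> \<alpha> j \<noteq> 0")
        case True
        then obtain j where j: "j < length l" "i \<le> j" "\<alpha> j \<noteq> 0" by blast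
        have "l ! i \<le> l ! j" using part j by (auto simp: is_partition_def intro: sorted_nth_mono)
        also have "l ! j \<le> \<alpha> j * l ! j" using j by simp
        also have "\<dots> \<le> t" unfolding \<alpha>(1) using j by (intro member_le_sum) auto
        finally show False using t big by simp
      next
        case False
        then have "t = (\<Sum>j<i. \<alpha> j * l ! j)"
          unfolding \<alpha>(1) using i by (intro sum.mono_neutral_right) auto
        also have "\<dots> \<le> (\<Sum>j<i. r * l ! j)" using \<alpha>(2) i by (intro sum_mono mult_right_mono) auto
        also have "\<dots> = R" by (simp add: R_def sum_distrib_left)
        finally show False using t by simp
      qed
    qed
    ultimately show False using er unfolding er_partition_def by blast
  qed
next
  assume *: "is_partition m l \<and> parts_bounded e r l"
  have "\<exists>t\<in>{a..a + e}. t \<in> represented r l" if "a + e \<le> r * m" for a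
  proof -
    have "a + e \<le> r * (\<Sum>j<length l. l ! j)"
      using that * by (simp add: is_partition_def sum_list_eq_sum)
    \<comment> \<open>Applied to the top a + e of the window, so that the sum found lies in
      it.\<close>
    then obtain \<alpha> where \<alpha>: "\<forall>j<length l. \<alpha> j \<le> r" "(\<Sum>j<length l. \<alpha> j * l ! j) \<le> a + e"
      "a + e \<le> (\<Sum>j<length l. \<alpha> j * l ! j) + e"
      using representable_below[of e r l "length l" "a + e"] * by (auto simp: is_partition_def)
    then show ?thesis
      by (intro bexI[of _ "\<Sum>j<length l. \<alpha> j * l ! j"]) (auto simp: represented_def)
  qed
  then show "er_partition e r m l" using * by (auto simp: er_partition_def)
qed

text \<open>The partial sums satisfy as an inequality the recursion that \<open>max_sum\<close>
  satisfies with equality.\<close>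

lemma sum_list_le_max_sum:
  assumes "r \<ge> 1" "parts_bounded e r l"
  shows "sum_list l \<le> max_sum e r (length l)"
proof -
  have "(\<Sum>j<k. l ! j) \<le> max_sum e r k" if "k \<le> length l" for k
    using that
  proof (induction k)
    case (Suc k)
    have "l ! k \<le> e + 1 + r * (\<Sum>j<k. l ! j)" using assms(2) Suc.prems by (simp add: parts_bounded_def)
    moreover have "(r + 1) * (\<Sum>j<k. l ! j) \<le> (r + 1) * max_sum e r k"
      using Suc by (intro mult_left_mono) auto
    ultimately show ?case by (simp add: max_sum_Suc[OF assms(1)])
  qed simp
  then show ?thesis by (simp add: sum_list_eq_sum)
qed

lemma part_plus_length_le:
  "x \<in> set l \<Longrightarrow> \<forall>a\<in>set l. 0 < a \<Longrightarrow> x + length l \<le> sum_list l + 1" for l :: "nat list"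
proof (induction l)
  case (Cons a l)
  have "length l \<le> sum_list l" using Cons.prems(2) by (induction l) auto
  with Cons show ?case by fastforce
qed simp

text \<open>
  The last part is \<open>m - m'\<close>, where \<open>m' = \<lceil>(m - e - 1) / (r + 1)\<rceil>\<close> is the least sum of the other parts
  that permits it, unless this is less than their number.
\<close>

lemma ex_bounded_partition:
  assumes "r \<ge> 1" "Suc k \<le> m" "m \<le> max_sum e r (Suc k)"
  shows "\<exists>l. is_partition m l \<and> parts_bounded e r l \<and> length l = Suc k"
  using assms(2,3)
proof (induction k arbitrary: m)
  case 0
  then show ?case using assms(1)
    by (intro exI[of _ "[m]"]) (simp add: is_partition_def parts_bounded_def max_sum_Suc)
next
  case (Suc k)
  define x where "x = m - (e + 1)"
  define q where "q = (x + r) div (r + 1)"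
  define m' where "m' = max (Suc k) q"
  have "x + r < q * (r + 1) + (r + 1)"
    using dividend_less_times_div[of "r + 1" "x + r"] unfolding q_def
    by (simp only: mult.commute add.commute)
  then have x_le: "x \<le> q * (r + 1)" by simp
  have "q * (r + 1) \<le> x + r" unfolding q_def by (rule div_times_less_eq_dividend)
  have q2: "2 * q \<le> x + 1"
  proof (cases q)
    case (Suc p)
    then have "p * r + p + 1 \<le> x" using \<open>q * (r + 1) \<le> x + r\<close> by simp
    moreover have "p * 1 \<le> p * r" using assms(1) by (intro mult_left_mono) auto
    ultimately show ?thesis using Suc by linarith
  qed simp
  have "x \<le> (r + 1) * max_sum e r (Suc k)"
    using Suc.prems(2) max_sum_Suc[OF assms(1), of e "Suc k"] by (simp add: x_def)
  then have "x + r < (max_sum e r (Suc k) + 1) * (r + 1)" by (simp add: algebra_simps)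
  then have "q < max_sum e r (Suc k) + 1" unfolding q_def by (simp only: div_less_iff_less_mult zero_less_Suc add_gr_0 zero_less_one simp_thms)
  then have m': "Suc k \<le> m'" "m' \<le> max_sum e r (Suc k)"
    using le_max_sum[OF assms(1), of "Suc k" e] by (auto simp: m'_def)
  then obtain l where l: "is_partition m' l" "parts_bounded e r l" "length l = Suc k"
    using Suc.IH by blast
  \<comment> \<open>The other parts are at most m' - k, being k + 1 positive numbers of sum m'; this
    bound makes m - m' at least as large.\<close>
  have m'2: "2 * m' \<le> m + k"
    using q2 Suc.prems(1) by (auto simp: m'_def x_def max_def)
  have le: "a \<le> m - m'" if "a \<in> set l" for a
    using part_plus_length_le[OF that] l m'2 m' by (simp add: is_partition_def)
  have "m' < m" using m'2 m' Suc.prems by simp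
  have "m - m' \<le> e + 1 + r * m'"
  proof -
    have "x \<le> m' * (r + 1)" using x_le mult_right_mono[of q m' "r + 1"] by (simp add: m'_def)
    then show ?thesis by (simp add: x_def algebra_simps)
  qed
  then have "parts_bounded e r (l @ [m - m'])"
    using l by (auto simp: parts_bounded_def nth_append is_partition_def sum_list_eq_sum less_Suc_eq)
  moreover have "is_partition m (l @ [m - m'])"
    using l le \<open>m' < m\<close> by (auto simp: is_partition_def sorted_append)
  ultimately show ?case using l(3) by (intro exI[of _ "l @ [m - m']"]) auto
qed

text \<open>The lower bound on m rules out n or fewer parts, and \<open>ex_bounded_partition\<close>
  shows that n + 1 parts are attained.\<close>

lemma minimal_er_partition_iff:
  assumes r: "r \<ge> 1" and m: "max_sum e r n + 1 \<le> m" "m \<le> max_sum e r (Suc n)"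
  shows "minimal_er_partition e r m l \<longleftrightarrow> is_partition m l \<and> parts_bounded e r l \<and> length l = Suc n"
proof -
  have lb: "Suc n \<le> length l'" if "er_partition e r m l'" for l'
  proof (rule ccontr)
    assume "\<not> Suc n \<le> length l'"
    then have "max_sum e r (length l') \<le> max_sum e r n" by (intro max_sum_mono r) simp
    moreover have "m \<le> max_sum e r (length l')"
      using that sum_list_le_max_sum[OF r, of e l'] by (auto simp: er_partition_iff[OF r] is_partition_def)
    ultimately show False using m by simp
  qed
  have "Suc n \<le> m" using m le_max_sum[OF r, of n e] by simp
  then obtain l0 where "er_partition e r m l0" "length l0 = Suc n"
    using ex_bounded_partition[OF r _ m(2)] by (auto simp: er_partition_iff[OF r])
  then show ?thesis
    unfolding minimal_er_partition_def er_partition_iff[OF r, symmetric] conj_assoc[symmetric]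
    using lb by (metis le_antisym)
qed

subsection \<open>Partitions as lattice points\<close>

text \<open>By the geometric sum, lower bounds on \<mu> turn into the bounds on the parts, with 0
  \<le> \<mu> 0 as the case of an empty sum; upper bounds turn into monotonicity and positivity of L
  0.\<close>

lemma lattice_points_complement:
  fixes \<mu> :: "nat \<Rightarrow> int" and e r :: nat
  defines "L \<equiv> \<lambda>i. (int e + 1) * (int r + 1) ^ i - \<mu> i"
  shows "\<mu> \<in> lattice_points (polyP n e r) \<longleftrightarrow>
    1 \<le> L 0 \<and> (\<forall>i\<in>{1..n}. L (i - 1) \<le> L i) \<and> (\<forall>i\<le>n. L i \<le> int e + 1 + int r * (\<Sum>j<i. L j)) \<and>
    (\<forall>i>n. \<mu> i = 0)"
proof -
  have geo: "int r * (\<Sum>j<i. (int e + 1) * (int r + 1) ^ j) = (int e + 1) * ((int r + 1) ^ i - 1)" for i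
    by (induction i) (auto simp: algebra_simps)
  have rL: "int r * (\<Sum>j<i. L j) = (int e + 1) * ((int r + 1) ^ i - 1) - int r * (\<Sum>j<i. \<mu> j)" for i
    unfolding geo[symmetric] L_def by (simp add: sum_subtractf right_diff_distrib)
  have "L i = (int e + 1) * (int r + 1) ^ i - \<mu> i" for i by (simp add: L_def)
  then have low: "int r * (\<Sum>j<i. \<mu> j) \<le> \<mu> i \<longleftrightarrow> L i \<le> int e + 1 + int r * (\<Sum>j<i. L j)" for i
    unfolding rL by (simp add: right_diff_distrib)
  have up: "\<mu> i \<le> (int e + 1) * int r * (int r + 1) ^ (i - 1) + \<mu> (i - 1) \<longleftrightarrow> L (i - 1) \<le> L i"
    if "i \<in> {1..n}" for i
    using that by (cases i) (auto simp: L_def algebra_simps)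
  have "(\<forall>i\<le>n. L i \<le> int e + 1 + int r * (\<Sum>j<i. L j)) \<longleftrightarrow>
     0 \<le> \<mu> 0 \<and> (\<forall>i\<in>{1..n}. int r * (\<Sum>j<i. \<mu> j) \<le> \<mu> i)"
    unfolding low[symmetric] by (auto simp: Suc_le_eq)
  moreover have "\<mu> 0 \<le> int e \<longleftrightarrow> 1 \<le> L 0" by (auto simp: L_def)
  ultimately show ?thesis unfolding lattice_points_iff using up by blast
qed

lemma card_minimal_er_partitions:
  assumes r: "r \<ge> 1" and m: "max_sum e r n + 1 \<le> m" "m \<le> max_sum e r (Suc n)"
  shows "card {l. minimal_er_partition e r m l} =
    card {\<mu> \<in> lattice_points (polyP n e r). coord_sum n \<mu> = int (max_sum e r (Suc n)) - int m}"
proof -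
  define M where "M i = (int e + 1) * (int r + 1) ^ i" for i
  define f where "f l = (\<lambda>i. if i \<le> n then M i - int (l ! i) else 0)" for l :: "nat list"
  define g where "g \<mu> = map (\<lambda>i. nat (M i - \<mu> i)) [0..<Suc n]" for \<mu>
  let ?A = "{l. is_partition m l \<and> parts_bounded e r l \<and> length l = Suc n}"
  let ?B = "{\<mu> \<in> lattice_points (polyP n e r). coord_sum n \<mu> = int (max_sum e r (Suc n)) - int m}"
  have max_sum: "int (max_sum e r (Suc n)) = (\<Sum>i\<le>n. M i)"
    unfolding max_sum_eq_sum[OF r] lessThan_Suc_atMost M_def
    by (simp only: of_nat_sum of_nat_mult of_nat_power of_nat_add of_nat_1)
  \<comment> \<open>Ensures that the truncation \<open>nat\<close> in \<open>g\<close> loses nothing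
    and that the parts are positive.\<close>
  have pos: "1 \<le> M i - \<mu> i" if "\<mu> \<in> lattice_points (polyP n e r)" "i \<le> n" for \<mu> i
    using that(2)
  proof (induction i)
    case 0
    then show ?case using that(1) by (simp add: lattice_points_complement M_def)
  next
    case (Suc i)
    have "M (Suc i - 1) - \<mu> (Suc i - 1) \<le> M (Suc i) - \<mu> (Suc i)"
      using that(1) Suc.prems unfolding lattice_points_complement M_def by (metis Suc_leI atLeastAtMost_iff zero_less_Suc One_nat_def)
    then show ?case using Suc by simp
  qed
  have "bij_betw f ?A ?B"
  proof (rule bij_betw_byWitness[where f' = g])
    show "\<forall>l\<in>?A. g (f l) = l"
      by (auto simp: f_def g_def intro!: nth_equalityI simp del: upt_Suc)
    show "\<forall>\<mu>\<in>?B. f (g \<mu>) = \<mu>"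
    proof
      fix \<mu> assume \<mu>: "\<mu> \<in> ?B"
      have "f (g \<mu>) i = \<mu> i" for i
      proof (cases "i \<le> n")
        case True
        then show ?thesis using \<mu> pos[of \<mu> i] by (simp add: f_def g_def del: upt_Suc)
      next
        case False
        then show ?thesis using \<mu> by (auto simp: f_def lattice_points_complement)
      qed
      then show "f (g \<mu>) = \<mu>" by blast
    qed
    show "f ` ?A \<subseteq> ?B"
    proof (rule image_subsetI)
      fix l assume "l \<in> ?A"
      then have l: "is_partition m l" "parts_bounded e r l" "length l = Suc n" by auto
      have M: "M i - f l i = int (l ! i)" if "i \<le> n" for i using that by (simp add: f_def)
      have "1 \<le> M 0 - f l 0" using l M[of 0] by (simp add: is_partition_def Suc_le_eq)
      moreover have "M (i - 1) - f l (i - 1) \<le> M i - f l i" if "i \<in> {1..n}" for i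
      proof -
        have "l ! (i - 1) \<le> l ! i" using l that by (intro sorted_nth_mono) (auto simp: is_partition_def)
        moreover have "i \<le> n" "i - 1 \<le> n" using that by auto
        ultimately show ?thesis by (simp only: M of_nat_le_iff)
      qed
      moreover have "M i - f l i \<le> int e + 1 + int r * (\<Sum>j<i. M j - f l j)" if "i \<le> n" for i
      proof -
        have "l ! i \<le> e + 1 + r * (\<Sum>j<i. l ! j)" using l that by (simp add: parts_bounded_def)
        then have "int (l ! i) \<le> int (e + 1 + r * (\<Sum>j<i. l ! j))" by (simp only: of_nat_le_iff)
        moreover have "(\<Sum>j<i. M j - f l j) = (\<Sum>j<i. int (l ! j))" using that by (intro sum.cong M) auto
        ultimately show ?thesis using M[OF that] by simp
      qed
      moreover have "f l i = 0" if "i > n" for i using that by (simp add: f_def)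
      ultimately have "f l \<in> lattice_points (polyP n e r)"
        unfolding lattice_points_complement M_def by blast
      moreover have "(\<Sum>i\<le>n. M i - f l i) = (\<Sum>i\<le>n. int (l ! i))" by (intro sum.cong M) auto
      then have "coord_sum n (f l) = int (max_sum e r (Suc n)) - int m"
        using l unfolding max_sum coord_sum_def
        by (simp add: sum_subtractf is_partition_def sum_list_eq_sum lessThan_Suc_atMost flip: of_nat_sum)
      ultimately show "f l \<in> ?B" by blast
    qed
    show "g ` ?B \<subseteq> ?A"
    proof (rule image_subsetI)
      fix \<mu> assume "\<mu> \<in> ?B"
      then have \<mu>: "\<mu> \<in> lattice_points (polyP n e r)" "coord_sum n \<mu> = int (max_sum e r (Suc n)) - int m"
        by auto
      have len: "length (g \<mu>) = Suc n" by (simp add: g_def)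
      have nth: "int (g \<mu> ! i) = M i - \<mu> i" if "i \<le> n" for i
        using pos[OF \<mu>(1) that] that by (simp add: g_def del: upt_Suc)
      have "int (g \<mu> ! i) \<le> int (g \<mu> ! Suc i)" if "Suc i \<le> n" for i
      proof -
        have "M (Suc i - 1) - \<mu> (Suc i - 1) \<le> M (Suc i) - \<mu> (Suc i)"
          using \<mu>(1) that unfolding lattice_points_complement M_def
          by (metis Suc_leI atLeastAtMost_iff zero_less_Suc One_nat_def)
        then show ?thesis using nth[OF that] nth[of i] that by simp
      qed
      then have "sorted (g \<mu>)" using len by (simp add: sorted_iff_nth_Suc)
      moreover have "\<forall>a\<in>set (g \<mu>). 0 < a"
      proof
        fix a assume "a \<in> set (g \<mu>)"
        then obtain i where "i \<le> n" "a = g \<mu> ! i" using len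
          by (metis in_set_conv_nth less_Suc_eq_le)
        then show "0 < a" using nth pos[OF \<mu>(1)] by fastforce
      qed
      moreover have "int (sum_list (g \<mu>)) = int m"
      proof -
        have "int (sum_list (g \<mu>)) = (\<Sum>i\<le>n. M i - \<mu> i)"
          unfolding sum_list_eq_sum len lessThan_Suc_atMost of_nat_sum by (intro sum.cong nth) auto
        then show ?thesis using \<mu>(2) unfolding max_sum coord_sum_def by (simp add: sum_subtractf)
      qed
      ultimately have "is_partition m (g \<mu>)" using len by (auto simp: is_partition_def)
      moreover have "parts_bounded e r (g \<mu>)"
        unfolding parts_bounded_def
      proof (intro allI impI)
        fix i assume "i < length (g \<mu>)"
        then have i: "i \<le> n" using len by simp
        have "M i - \<mu> i \<le> int e + 1 + int r * (\<Sum>j<i. M j - \<mu> j)"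
          using \<mu>(1) i unfolding lattice_points_complement M_def by blast
        also have "(\<Sum>j<i. M j - \<mu> j) = (\<Sum>j<i. int (g \<mu> ! j))"
          using i by (intro sum.cong nth[symmetric]) auto
        finally have "int (g \<mu> ! i) \<le> int (e + 1 + r * (\<Sum>j<i. g \<mu> ! j))" using nth[OF i] by simp
        then show "g \<mu> ! i \<le> e + 1 + r * (\<Sum>j<i. g \<mu> ! j)" by (simp only: of_nat_le_iff)
      qed
      ultimately show "g \<mu> \<in> ?A" using len by blast
    qed
  qed
  then have "card ?A = card ?B" by (rule bij_betw_same_card)
  then show ?thesis unfolding minimal_er_partition_iff[OF assms] .
qed

lemma fls_nth_sigma_P:
  "fls_nth (sigma_P n e r) k = of_nat (card {\<mu> \<in> lattice_points (polyP n e r). coord_sum n \<mu> = k})"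
proof -
  have "fls_nth (\<Sum>\<mu>\<in>A. fls_X_intpow (coord_sum n \<mu>) :: rat fls) k =
    (\<Sum>\<mu>\<in>A. if coord_sum n \<mu> = k then 1 else 0)" if "finite A" for A
    using that by (induction A) (auto simp: fls_plus_nth)
  from this[OF finite_lattice_points] show ?thesis
    unfolding sigma_P_def by (simp add: finite_lattice_points sum.If_cases Int_def)
qed

theorem mainTheorem2:
  fixes e r n :: nat
  assumes "r \<ge> 1"
  shows "(\<exists>R :: rat fps. (\<forall>k < (e + 1) * (r + 1) ^ n. fps_nth R k = 0) \<and>
           sigma_P n e r =
             sigma_K n e r (vertex n e r {})
             + (\<Sum>j = 1..n. sigma_K n e r (vertex n e r {j}))
             + chi r * (\<Sum>j1 = 1..n. \<Sum>j2 = j1 + 2..n. sigma_K n e r (vertex n e r {j1, j2}))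
             + fps_to_fls R)
       \<and> (\<forall>m :: nat.
            (e + 1) * (((r + 1) ^ n - 1) div r) + 1 \<le> m \<and>
            m \<le> (e + 1) * (((r + 1) ^ (n + 1) - 1) div r) \<longrightarrow>
            of_nat (card {l. minimal_er_partition e r m l}) =
              fls_nth (sigma_P n e r)
                (int ((e + 1) * (((r + 1) ^ (n + 1) - 1) div r)) - int m))"
proof (intro conjI allI impI)
  show "\<exists>R :: rat fps. (\<forall>k < (e + 1) * (r + 1) ^ n. fps_nth R k = 0) \<and>
      sigma_P n e r =
        sigma_K n e r (vertex n e r {})
        + (\<Sum>j = 1..n. sigma_K n e r (vertex n e r {j}))
        + chi r * (\<Sum>j1 = 1..n. \<Sum>j2 = j1 + 2..n. sigma_K n e r (vertex n e r {j1, j2}))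
        + fps_to_fls R"
    using sigma_P_expansion[OF assms, of e n] by blast
next
  fix m :: nat
  assume "(e + 1) * (((r + 1) ^ n - 1) div r) + 1 \<le> m \<and>
    m \<le> (e + 1) * (((r + 1) ^ (n + 1) - 1) div r)"
  then have "max_sum e r n + 1 \<le> m" "m \<le> max_sum e r (Suc n)" by (simp_all add: max_sum_def)
  from card_minimal_er_partitions[OF assms this]
  show "of_nat (card {l. minimal_er_partition e r m l}) =
      fls_nth (sigma_P n e r) (int ((e + 1) * (((r + 1) ^ (n + 1) - 1) div r)) - int m)"
    by (simp add: fls_nth_sigma_P max_sum_def)
qed

end
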